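(* Let $G$ be a finite-dimensional Lie group acting on $G\times G$ by $\bar g:(g_1,g_2)\mapsto(g_1\bar g,g_2\bar g)$, let $\mathbb L:G\times G\to\mathbb R$ be a smooth function invariant under this action, with $\omega_{\mathbb L}$ nondegenerate, and let $\ell:G\to\mathbb R$ be given by $\ell(g_1g_2^{-1})=\mathbb L(g_1,g_2)$. If the action of $G$ on $G\times G$ is proper, then the algorithm $f_{k-1\,k}\mapsto f_{k\,k+1}$ on $G$ defined by the discrete Euler-Poincaré equations preserves the induced Poisson structure $\{\cdot,\cdot\}_G$ on $G$ given by $$\{f,h\}_G\circ\pi=\{f\circ\pi,h\circ\pi\}_{G\times G}$$ for any $C^1$ functions $f,h:(G\times G)/G\cong G\to\mathbb R$. That is, if $\Phi:V\to G$ ($V\subset G$ open) is a smooth map such that the pair $(f_{k-1\,k},f_{k\,k+1})=(a,\Phi(a))$ satisfies the discrete Euler-Poincaré equation for every $a\in V$, then $\{f\circ\Phi,h\circ\Phi\}_G=\{f,h\}_G\circ\Phi$ on $V$ for all $C^1$ functions $f,h$ on $G$.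
   Context: $\pi:G\times G\to(G\times G)/G\cong G$ is $\pi(g_1,g_2)=g_1g_2^{-1}$. The discrete symplectic form $\omega_{\mathbb L}$ on $G\times G$ is given in coordinates $(g_k^i,g_{k+1}^j)$ by $$\omega_{\mathbb L}=\frac{\partial^2\mathbb L}{\partial g_k^i\,\partial g_{k+1}^j}\,dg_k^i\wedge dg_{k+1}^j .$$ For a $C^1$ function $F$ on $G\times G$, its Hamiltonian vector field $X_F$ is defined by $X_F\lrcorner\,\omega_{\mathbb L}=dF$ (interior product), and the Poisson structure on $G\times G$ is $\{F,H\}_{G\times G}=\omega_{\mathbb L}(X_F,X_H)$. The discrete Euler-Poincaré (DEP) equation for a pair $(f_{k-1\,k},f_{k\,k+1})\in G\times G$ is: for all $\vartheta\in\mathfrak g$, $$-\ell'(f_{k-1\,k})\cdot TR_{f_{k-1\,k}}\bigl(\operatorname{Ad}_{f_{k-1\,k}}\vartheta\bigr)+\ell'(f_{k\,k+1})\cdot TR_{f_{k\,k+1}}(\vartheta)=0,$$ where $\ell'$ is the differential of $\ell$, $TR_f:\mathfrak g\to T_fG$ is the tangent map at $e$ of right translation $R_f(g)=gf$, and $\operatorname{Ad}$ is the adjoint action. The DEP algorithm is the (smooth, possibly only locally defined) map $f_{k-1\,k}\mapsto f_{k\,k+1}$ obtained by solving this equation for $f_{k\,k+1}$. *)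

theory Defs
  imports "HOL-Analysis.Analysis"
begin

section \<open>Maps of class \<open>C\<^sup>k\<close> between normed spaces\<close>

text \<open>
  Only used for open \<open>S\<close> in a finite-dimensional space, where requiring every directional
  derivative \<open>x \<mapsto> Df(x)v\<close> to be \<open>C\<^sup>n\<close> is the same as requiring \<open>Df\<close> to be \<open>C\<^sup>n\<close>.
\<close>

primrec C_nat_on ::
    "nat \<Rightarrow> 'a::real_normed_vector set \<Rightarrow> ('a \<Rightarrow> 'b::real_normed_vector) \<Rightarrow> bool" where
  "C_nat_on 0 S f \<longleftrightarrow> continuous_on S f"
| "C_nat_on (Suc n) S f \<longleftrightarrow>
     (\<forall>x\<in>S. f differentiable (at x)) \<and>
     (\<forall>v. C_nat_on n S (\<lambda>x. frechet_derivative f (at x) v))"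

definition Ck_on ::
    "enat \<Rightarrow> 'a::real_normed_vector set \<Rightarrow> ('a \<Rightarrow> 'b::real_normed_vector) \<Rightarrow> bool" where
  "Ck_on k S f \<longleftrightarrow> (\<forall>n. enat n \<le> k \<longrightarrow> C_nat_on n S f)"

section \<open>Smooth manifolds\<close>

text \<open>
  A chart \<open>(U, \<phi>)\<close> is a homeomorphism \<open>\<phi>\<close> from the open set \<open>U\<close> onto an open set of the model
  space; the values of \<open>\<phi>\<close> outside \<open>U\<close> are irrelevant.  The manifold is the whole type \<open>'m\<close>;
  atlases are not required to be maximal.
\<close>

type_synonym ('m, 'e) chart = "'m set \<times> ('m \<Rightarrow> 'e)"

definition smooth_atlas ::
    "('m::topological_space, 'e::real_normed_vector) chart set \<Rightarrow> bool" where
  "smooth_atlas A \<longleftrightarrow>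
     (\<forall>(U, \<phi>)\<in>A. open U \<and> open (\<phi> ` U) \<and> homeomorphism U (\<phi> ` U) \<phi> (inv_into U \<phi>)) \<and>
     (\<Union>(U, \<phi>)\<in>A. U) = UNIV \<and>
     (\<forall>(U, \<phi>)\<in>A. \<forall>(W, \<psi>)\<in>A. Ck_on \<infinity> (\<phi> ` (U \<inter> W)) (\<psi> \<circ> inv_into U \<phi>))"

definition prod_atlas ::
    "('m, 'e) chart set \<Rightarrow> ('n, 'f) chart set \<Rightarrow> ('m \<times> 'n, 'e \<times> 'f) chart set" where
  "prod_atlas A A' = {(U \<times> W, map_prod \<phi> \<psi>) | U \<phi> W \<psi>. (U, \<phi>) \<in> A \<and> (W, \<psi>) \<in> A'}"

definition real_atlas :: "(real, real) chart set" where
  "real_atlas = {(UNIV, \<lambda>t. t)}"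

text \<open>Class \<open>C\<^sup>k\<close> on an open subset \<open>S\<close> of a manifold.\<close>

definition Ck_map_on ::
    "enat \<Rightarrow> ('m::topological_space, 'e::real_normed_vector) chart set
      \<Rightarrow> ('n::topological_space, 'f::real_normed_vector) chart set
      \<Rightarrow> 'm set \<Rightarrow> ('m \<Rightarrow> 'n) \<Rightarrow> bool" where
  "Ck_map_on k A A' S f \<longleftrightarrow>
     continuous_on S f \<and>
     (\<forall>(U, \<phi>)\<in>A. \<forall>(W, \<psi>)\<in>A'.
        Ck_on k (\<phi> ` {p \<in> S \<inter> U. f p \<in> W}) (\<psi> \<circ> f \<circ> inv_into U \<phi>))"

text \<open>
  Tangent vectors at \<open>p\<close> are represented by their components in one fixed chart around \<open>p\<close>,
  so that every tangent space is a copy of the model space.  Everything below that refers to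
  tangent vectors at \<open>p\<close> uses the same chart \<open>chart_at A p\<close>.
\<close>

definition chart_at :: "('m, 'e) chart set \<Rightarrow> 'm \<Rightarrow> ('m, 'e) chart" where
  "chart_at A p = (SOME c. c \<in> A \<and> p \<in> fst c)"

definition tangent_map ::
    "('m, 'e::real_normed_vector) chart set \<Rightarrow> ('n, 'f::real_normed_vector) chart set
      \<Rightarrow> ('m \<Rightarrow> 'n) \<Rightarrow> 'm \<Rightarrow> 'e \<Rightarrow> 'f" where
  "tangent_map A A' f p =
     (let (U, \<phi>) = chart_at A p; (W, \<psi>) = chart_at A' (f p)
      in frechet_derivative (\<psi> \<circ> f \<circ> inv_into U \<phi>) (at (\<phi> p)))"

abbreviation differential ::
    "('m, 'e::real_normed_vector) chart set \<Rightarrow> ('m \<Rightarrow> real) \<Rightarrow> 'm \<Rightarrow> 'e \<Rightarrow> real" where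
  "differential A f p \<equiv> tangent_map A real_atlas f p"

section \<open>Finite-dimensional Lie groups\<close>

text \<open>
  \<open>B\<close> is the basis of the model space that defines the coordinates \<open>g\<^sup>i\<close>; the dimension of the
  group is \<open>card B\<close>, and \<open>B = {}\<close> (dimension zero) is allowed, which it would not be with a
  model space of class \<open>euclidean_space\<close>.
\<close>

locale lie_group = group mul e ginv
  for mul :: "'g::{t2_space, second_countable_topology} \<Rightarrow> 'g \<Rightarrow> 'g"
    and e :: 'g and ginv :: "'g \<Rightarrow> 'g" +
  fixes A :: "('g, 'e::real_normed_vector) chart set"
    and B :: "'e set"
  assumes finite_basis: "finite B" "independent B" "span B = UNIV"
    and atlas: "smooth_atlas A"
    and smooth_mult: "Ck_map_on \<infinity> (prod_atlas A A) A UNIV (\<lambda>(g, h). mul g h)"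
    and smooth_inverse: "Ck_map_on \<infinity> A A UNIV ginv"

definition diag_action :: "('g \<Rightarrow> 'g \<Rightarrow> 'g) \<Rightarrow> 'g \<Rightarrow> 'g \<times> 'g \<Rightarrow> 'g \<times> 'g" where
  "diag_action mul g = (\<lambda>(g1, g2). (mul g1 g, mul g2 g))"

definition proper_action ::
    "('g::topological_space \<Rightarrow> 'm::topological_space \<Rightarrow> 'm) \<Rightarrow> bool" where
  "proper_action act \<longleftrightarrow> proper_map euclidean euclidean (\<lambda>(g, x). (act g x, x))"

definition quot_map :: "('g \<Rightarrow> 'g \<Rightarrow> 'g) \<Rightarrow> ('g \<Rightarrow> 'g) \<Rightarrow> 'g \<times> 'g \<Rightarrow> 'g" where
  "quot_map mul ginv = (\<lambda>(g1, g2). mul g1 (ginv g2))"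

definition right_tangent ::
    "('g \<Rightarrow> 'g \<Rightarrow> 'g) \<Rightarrow> 'g \<Rightarrow> ('g, 'e::real_normed_vector) chart set \<Rightarrow> 'g \<Rightarrow> 'e \<Rightarrow> 'e" where
  "right_tangent mul e A f = tangent_map A A (\<lambda>g. mul g f) e"

definition Ad ::
    "('g \<Rightarrow> 'g \<Rightarrow> 'g) \<Rightarrow> 'g \<Rightarrow> ('g \<Rightarrow> 'g) \<Rightarrow> ('g, 'e::real_normed_vector) chart set
      \<Rightarrow> 'g \<Rightarrow> 'e \<Rightarrow> 'e" where
  "Ad mul e ginv A g = tangent_map A A (\<lambda>h. mul (mul g h) (ginv g)) e"

section \<open>The discrete symplectic form and the Poisson brackets\<close>

text \<open>
  \<open>\<omega>(u,v) = \<Sum>\<^sub>i\<^sub>j \<partial>\<^sup>2L/\<partial>g\<^sub>k\<^sup>i\<partial>g\<^sub>k\<^sub>+\<^sub>1\<^sup>j (dg\<^sub>k\<^sup>i \<and> dg\<^sub>k\<^sub>+\<^sub>1\<^sup>j)(u,v)\<close>, with the convention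
  \<open>(\<alpha> \<and> \<beta>)(u,v) = \<alpha>(u)\<beta>(v) - \<alpha>(v)\<beta>(u)\<close>.
\<close>

definition discrete_symplectic ::
    "('g, 'e::real_normed_vector) chart set \<Rightarrow> 'e set \<Rightarrow> ('g \<times> 'g \<Rightarrow> real)
      \<Rightarrow> 'g \<times> 'g \<Rightarrow> 'e \<times> 'e \<Rightarrow> 'e \<times> 'e \<Rightarrow> real" where
  "discrete_symplectic A B L p u v =
     (let (Q, \<xi>) = chart_at (prod_atlas A A) p; (x, y) = \<xi> p
      in \<Sum>i\<in>B. \<Sum>j\<in>B.
           deriv (\<lambda>s. deriv (\<lambda>t. L (inv_into Q \<xi> (x + s *\<^sub>R i, y + t *\<^sub>R j))) 0) 0 *
           (representation B (fst u) i * representation B (snd v) j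
            - representation B (fst v) i * representation B (snd u) j))"

definition nondegenerate_form :: "('v::zero \<Rightarrow> 'v \<Rightarrow> real) \<Rightarrow> bool" where
  "nondegenerate_form \<omega> \<longleftrightarrow> (\<forall>u. (\<forall>v. \<omega> u v = 0) \<longrightarrow> u = 0)"

text \<open>
  The value at \<open>p\<close> depends only on \<open>F\<close> near \<open>p\<close>, so this and the brackets below also apply to
  functions that are \<open>C\<^sup>1\<close> only on an open set containing \<open>p\<close>.
\<close>

definition hamiltonian_vf ::
    "('g, 'e::real_normed_vector) chart set \<Rightarrow> 'e set \<Rightarrow> ('g \<times> 'g \<Rightarrow> real)
      \<Rightarrow> ('g \<times> 'g \<Rightarrow> real) \<Rightarrow> 'g \<times> 'g \<Rightarrow> 'e \<times> 'e" where
  "hamiltonian_vf A B L F p =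
     (THE X. \<forall>v. discrete_symplectic A B L p X v = differential (prod_atlas A A) F p v)"

definition poisson_GG ::
    "('g, 'e::real_normed_vector) chart set \<Rightarrow> 'e set \<Rightarrow> ('g \<times> 'g \<Rightarrow> real)
      \<Rightarrow> ('g \<times> 'g \<Rightarrow> real) \<Rightarrow> ('g \<times> 'g \<Rightarrow> real) \<Rightarrow> 'g \<times> 'g \<Rightarrow> real" where
  "poisson_GG A B L F H p =
     discrete_symplectic A B L p (hamiltonian_vf A B L F p) (hamiltonian_vf A B L H p)"

text \<open>
  The induced bracket at \<open>a\<close> is the common value of \<open>{f \<circ> \<pi>, h \<circ> \<pi>}\<close> on the fibre of the
  quotient map \<open>\<pi>\<close> over \<open>a\<close>.
\<close>

definition poisson_G ::
    "('g \<Rightarrow> 'g \<Rightarrow> 'g) \<Rightarrow> ('g \<Rightarrow> 'g) \<Rightarrow> ('g, 'e::real_normed_vector) chart set \<Rightarrow> 'e set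
      \<Rightarrow> ('g \<times> 'g \<Rightarrow> real) \<Rightarrow> ('g \<Rightarrow> real) \<Rightarrow> ('g \<Rightarrow> real) \<Rightarrow> 'g \<Rightarrow> real" where
  "poisson_G mul ginv A B L f h a =
     (THE r. \<forall>p. quot_map mul ginv p = a \<longrightarrow>
        poisson_GG A B L (f \<circ> quot_map mul ginv) (h \<circ> quot_map mul ginv) p = r)"

section \<open>The discrete Euler-Poincare equation\<close>

definition DEP ::
    "('g \<Rightarrow> 'g \<Rightarrow> 'g) \<Rightarrow> 'g \<Rightarrow> ('g \<Rightarrow> 'g) \<Rightarrow> ('g, 'e::real_normed_vector) chart set
      \<Rightarrow> ('g \<Rightarrow> real) \<Rightarrow> 'g \<Rightarrow> 'g \<Rightarrow> bool" where
  "DEP mul e ginv A \<l> a b \<longleftrightarrow>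
     (\<forall>\<theta>. - differential A \<l> a (right_tangent mul e A a (Ad mul e ginv A a \<theta>))
          + differential A \<l> b (right_tangent mul e A b \<theta>) = 0)"

end

theory Submission
  imports Defs
begin

text \<open>
  The reduced map \<open>\<Phi>\<close> preserves the bracket because it is the shadow of a symplectic map upstairs.
  On \<open>G \<times> G\<close> put \<open>\<phi>(g\<^sub>1, g\<^sub>2) = (g\<^sub>2, \<Phi>(g\<^sub>1 g\<^sub>2\<^sup>-\<^sup>1)\<^sup>-\<^sup>1 g\<^sub>2)\<close>, so that \<open>\<pi> \<circ> \<phi> = \<Phi> \<circ> \<pi>\<close>.  Writing
  \<open>L(g\<^sub>1, k) = \<l>(a (k g\<^sub>2\<^sup>-\<^sup>1)\<^sup>-\<^sup>1)\<close> and \<open>L(k, g\<^sub>3) = \<l>((k g\<^sub>2\<^sup>-\<^sup>1) b)\<close> for \<open>a = g\<^sub>1 g\<^sub>2\<^sup>-\<^sup>1\<close> and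
  \<open>b = g\<^sub>2 g\<^sub>3\<^sup>-\<^sup>1\<close>, the discrete Euler-Poincare equation for \<open>(a, b)\<close> says exactly that
  \<open>k \<mapsto> L(g\<^sub>1, k) + L(k, g\<^sub>3)\<close> is stationary at \<open>k = g\<^sub>2\<close>; this is the discrete Euler-Lagrange equation
  (lemma \<open>DEP_imp_discrete_Euler_Lagrange\<close>), and it makes \<open>L\<close> a generating function of \<open>\<phi>\<close>.

  A map with a generating function is symplectic.  In coordinates the equation reads
  \<open>\<partial>\<^sub>2L(x, y) + \<partial>\<^sub>1L(y, \<gamma>(x, y)) = 0\<close>.  Differentiating it once more in a direction \<open>u\<close>, pairing it with
  the middle component of \<open>v\<close>, and antisymmetrizing in \<open>u, v\<close>, the pure second derivatives
  \<open>\<partial>\<^sub>2\<partial>\<^sub>2L\<close> and \<open>\<partial>\<^sub>1\<partial>\<^sub>1L\<close> cancel by symmetry, and what is left is \<open>\<phi>\<^sup>*\<omega> = \<omega>\<close>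
  (lemmas \<open>mixed_form_generating_function\<close> and \<open>euler_lagrange_flow_symplectic\<close>).

  The form \<open>\<omega>\<close> only involves the mixed derivatives of \<open>L\<close>, which behave tensorially under a product map
  \<open>\<alpha> \<times> \<beta>\<close> that leaves \<open>L\<close> unchanged: no second derivative of \<open>\<alpha>\<close> or \<open>\<beta>\<close> ever appears (lemma
  \<open>mixed_form_product_map\<close>).  Changes of charts are such maps, so \<open>\<omega>\<close> does not depend on the charts; and so
  is the diagonal action, so \<open>\<omega>\<close> is invariant.

  Finally, the value at a point of a bracket defined by a nondegenerate form is linear algebra: it depends only
  on the form and the two differentials at this point, and is therefore preserved by every map whose
  tangent map preserves the form (lemmas \<open>form_bracket_natural\<close> and \<open>poisson_GG_symplectic_pullback\<close>).
  Applied to the action, whose orbits are the fibres of \<open>\<pi>\<close>, this shows that \<open>{f \<circ> \<pi>, h \<circ> \<pi>}\<close> is constant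
  on the fibres, so the bracket on \<open>G\<close> is well defined.  Applied to \<open>\<phi>\<close> at a point \<open>p\<close> over \<open>a\<close> it gives
  \<open>{f \<circ> \<Phi>, h \<circ> \<Phi>}(a) = {f \<circ> \<pi> \<circ> \<phi>, h \<circ> \<pi> \<circ> \<phi>}(p) = {f \<circ> \<pi>, h \<circ> \<pi>}(\<phi>(p)) = {f, h}(\<Phi>(a))\<close>.
\<close>

section \<open>Brackets of a nondegenerate bilinear form\<close>

lemma finite_span_contains_basis:
  fixes S :: "'v::real_vector set"
  assumes "finite S" "span S = UNIV"
  obtains C :: "'v set" where "finite C" "independent C" "span C = UNIV"
proof -
  obtain C where C: "C \<subseteq> S" "independent C" "S \<subseteq> span C"
    using maximal_independent_subset by blast
  have "span C = UNIV"
    using C(3) assms(2) by (metis span_mono span_span top.extremum_uniqueI)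
  thus ?thesis by (rule that[OF finite_subset[OF C(1) assms(1)] C(2)])
qed

lemma linear_inj_imp_surj_finite_span:
  fixes f :: "'v::real_vector \<Rightarrow> 'v"
  assumes "finite S" "span S = (UNIV :: 'v set)" "linear f" "inj f"
  shows "surj f"
proof -
  obtain C :: "'v set" where C: "finite C" "independent C" "span C = UNIV"
    by (rule finite_span_contains_basis[OF assms(1,2)])
  interpret finite_dimensional_vector_space "scaleR :: real \<Rightarrow> 'v \<Rightarrow> 'v" C
    using C by unfold_locales (auto simp: dependent_raw_def span_raw_def)
  show ?thesis
    using linear_inj_imp_surj assms(3,4) by (simp add: linear_def)
qed

lemma finite_span_prod:
  fixes B :: "'e::real_vector set"
  assumes "finite B" "span B = UNIV"
  obtains S :: "('e \<times> 'e) set" where "finite S" "span S = UNIV"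
proof -
  let ?S = "(\<lambda>b. (b, 0)) ` B \<union> (\<lambda>b. (0, b)) ` B"
  have lin: "linear (\<lambda>b::'e. (b, 0::'e))" "linear (\<lambda>b::'e. (0::'e, b))" by (auto intro!: linearI)
  have "(a, b) \<in> span ?S" for a b
  proof -
    have "(a, 0) \<in> span ?S" "(0, b) \<in> span ?S"
      using linear_span_image[OF lin(1), of B] linear_span_image[OF lin(2), of B] assms(2)
        span_mono[of "(\<lambda>b. (b, 0)) ` B" ?S] span_mono[of "(\<lambda>b. (0, b)) ` B" ?S] by auto
    from span_add[OF this] show ?thesis by simp
  qed
  hence "span ?S = UNIV" by auto
  thus ?thesis using that[of ?S] assms(1) by simp
qed

text \<open>
  The Riesz argument without an inner product: for a basis \<open>C\<close> the endomorphism
  \<open>J u = \<Sum>\<^sub>b \<omega>(u, b) b\<close> encodes the functional \<open>\<omega>(u, -)\<close>, so nondegeneracy makes it injective, hence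
  surjective, and \<open>J\<close> hits \<open>\<Sum>\<^sub>b \<alpha>(b) b\<close>.
\<close>

lemma nondegenerate_form_represents:
  fixes \<omega> :: "'v::real_vector \<Rightarrow> 'v \<Rightarrow> real"
  assumes fin: "finite S" "span S = (UNIV :: 'v set)"
    and bil: "bilinear \<omega>" and nd: "nondegenerate_form \<omega>" and \<alpha>: "linear \<alpha>"
  shows "\<exists>!X. \<forall>v. \<omega> X v = \<alpha> v"
proof -
  obtain C :: "'v set" where finC: "finite C" and indC: "independent C" and spanC: "span C = UNIV"
    by (rule finite_span_contains_basis[OF fin])
  have lin1: "linear (\<lambda>u. \<omega> u v)" and lin2: "linear (\<omega> u)" for u v
    using bil by (auto simp: bilinear_def)
  have determined: "\<beta> = \<gamma>" if "linear \<beta>" "linear \<gamma>" "\<And>b. b \<in> C \<Longrightarrow> \<beta> b = \<gamma> b"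
    for \<beta> \<gamma> :: "'v \<Rightarrow> real"
    using linear_eq_on_span[OF that(1,2), of C] that(3) spanC by auto
  define J where "J u = (\<Sum>b\<in>C. \<omega> u b *\<^sub>R b)" for u
  have linJ: "linear J"
    unfolding J_def
    by (intro linear_compose_sum ballI bounded_linear.linear linearI)
       (auto simp: linear_add[OF lin1] linear_scale[OF lin1] scaleR_add_left)
  have zero: "u = 0" if "\<forall>v. \<omega> u v = 0" for u
    using nd that by (auto simp: nondegenerate_form_def)
  have "u = 0" if "J u = 0" for u
  proof -
    have "\<omega> u b = 0" if "b \<in> C" for b
      using independentD[OF indC finC subset_refl _ that] \<open>J u = 0\<close> by (auto simp: J_def)
    hence "\<omega> u = (\<lambda>_. 0)" by (intro determined lin2 linear_zero) auto
    thus "u = 0" using zero by metis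
  qed
  hence "inj J" using linear_injective_0[OF linJ] by blast
  hence "surj J" by (rule linear_inj_imp_surj_finite_span[OF fin linJ])
  then obtain X where X: "J X = (\<Sum>b\<in>C. \<alpha> b *\<^sub>R b)" by (metis surjD)
  have "\<omega> X b = \<alpha> b" if "b \<in> C" for b
  proof -
    have "(\<Sum>b\<in>C. (\<omega> X b - \<alpha> b) *\<^sub>R b) = 0"
      using X by (simp add: J_def scaleR_diff_left sum_subtractf)
    from independentD[OF indC finC subset_refl this that] show ?thesis by simp
  qed
  hence ex: "\<omega> X = \<alpha>" by (intro determined lin2 \<alpha>) auto
  show ?thesis
  proof (rule ex1I)
    show "\<forall>v. \<omega> X v = \<alpha> v" by (simp add: ex)
    fix Y assume "\<forall>v. \<omega> Y v = \<alpha> v"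
    hence "\<forall>v. \<omega> (Y - X) v = 0" by (simp add: linear_diff[OF lin1] ex)
    thus "Y = X" using zero[of "Y - X"] by simp
  qed
qed

text \<open>
  Since \<open>T\<close> preserves the form and \<open>\<omega>\<close> is nondegenerate, \<open>T\<close> is injective, hence bijective; therefore it
  carries the vector representing \<open>\<alpha>' \<circ> T\<close> to the vector representing \<open>\<alpha>'\<close>.
\<close>

lemma form_bracket_natural:
  fixes \<omega> \<omega>' :: "'v::real_vector \<Rightarrow> 'v \<Rightarrow> real"
  assumes fin: "finite S" "span S = (UNIV :: 'v set)"
    and bil: "bilinear \<omega>" "bilinear \<omega>'"
    and nd: "nondegenerate_form \<omega>" "nondegenerate_form \<omega>'"
    and T: "linear T" and pres: "\<And>u v. \<omega>' (T u) (T v) = \<omega> u v"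
    and lin: "linear \<alpha>'" "linear \<beta>'"
    and pull: "\<And>v. \<alpha> v = \<alpha>' (T v)" "\<And>v. \<beta> v = \<beta>' (T v)"
  shows "\<omega> (THE X. \<forall>v. \<omega> X v = \<alpha> v) (THE X. \<forall>v. \<omega> X v = \<beta> v) =
         \<omega>' (THE X. \<forall>v. \<omega>' X v = \<alpha>' v) (THE X. \<forall>v. \<omega>' X v = \<beta>' v)"
proof -
  have "u = 0" if "T u = 0" for u
  proof -
    have "\<omega> u v = 0" for v
      using pres[of u v] that bil(2) by (simp add: bilinear_lzero)
    thus ?thesis using nd(1) by (auto simp: nondegenerate_form_def)
  qed
  hence "inj T" using linear_injective_0[OF T] by blast
  hence surj: "surj T" by (rule linear_inj_imp_surj_finite_span[OF fin T])
  have pushes: "T (THE X. \<forall>v. \<omega> X v = \<gamma> v) = (THE X. \<forall>v. \<omega>' X v = \<gamma>' v)"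
    if "linear \<gamma>'" "\<And>v. \<gamma> v = \<gamma>' (T v)" for \<gamma> \<gamma>'
  proof -
    have "\<gamma> = \<gamma>' \<circ> T" by (simp add: fun_eq_iff that(2))
    hence "linear \<gamma>" using linear_compose[OF T that(1)] by simp
    from theI'[OF nondegenerate_form_represents[OF fin bil(1) nd(1) this]]
    have X: "\<omega> (THE X. \<forall>v. \<omega> X v = \<gamma> v) v = \<gamma> v" for v by blast
    have "\<omega>' (T (THE X. \<forall>v. \<omega> X v = \<gamma> v)) v = \<gamma>' v" for v
    proof -
      obtain w where "v = T w" using surj by (metis surjD)
      thus ?thesis using X that(2) pres by simp
    qed
    thus ?thesis
      by (intro the1_equality[OF nondegenerate_form_represents[OF fin bil(2) nd(2) that(1)], symmetric])
         blast
  qed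
  show ?thesis
    by (simp only: pres flip: pushes[OF lin(1) pull(1)] pushes[OF lin(2) pull(2)])
qed

section \<open>Second derivatives\<close>

text \<open>
  The direction \<open>v\<close> is differentiated first and \<open>w\<close> second.  Keeping directions as arguments avoids the
  normed space of bounded linear maps, and matches the recursion in \<^const>\<open>C_nat_on\<close>.
\<close>

definition second_derivative ::
    "('a::real_normed_vector \<Rightarrow> 'b::real_normed_vector) \<Rightarrow> 'a \<Rightarrow> 'a \<Rightarrow> 'a \<Rightarrow> 'b" where
  "second_derivative F z v w = frechet_derivative (\<lambda>x. frechet_derivative F (at x) v) (at z) w"

lemma C2_on_first:
  assumes "C_nat_on 2 S F" "z \<in> S"
  shows "(F has_derivative frechet_derivative F (at z)) (at z)"
  using assms by (simp add: numeral_2_eq_2 frechet_derivative_works[symmetric])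

lemma C2_on_second:
  assumes "C_nat_on 2 S F" "z \<in> S"
  shows "((\<lambda>x. frechet_derivative F (at x) v) has_derivative second_derivative F z v) (at z)"
  using assms
  by (simp add: numeral_2_eq_2 second_derivative_def[abs_def] frechet_derivative_works[symmetric])

lemma C2_on_continuous_second:
  assumes "C_nat_on 2 S F"
  shows "continuous_on S (\<lambda>z. second_derivative F z v w)"
  using assms by (simp add: numeral_2_eq_2 second_derivative_def)

lemma bilinear_second_derivative:
  assumes F: "C_nat_on 2 S F" and S: "open S" "z \<in> S"
  shows "bilinear (second_derivative F z)"
proof -
  note D2 = C2_on_second[OF F S(2)]
  have lin: "linear (frechet_derivative F (at x))" if "x \<in> S" for x
    using C2_on_first[OF F that] has_derivative_linear by blast
  have eqI: "second_derivative F z v = g"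
    if "(h has_derivative g) (at z)" "\<And>x. x \<in> S \<Longrightarrow> h x = frechet_derivative F (at x) v" for v g h
    using has_derivative_unique[OF D2 has_derivative_transform_within_open[OF that(1) S that(2)]] .
  have add: "second_derivative F z (v + v') = (\<lambda>w. second_derivative F z v w + second_derivative F z v' w)"
    for v v'
    by (rule eqI[OF has_derivative_add[OF D2 D2]]) (simp add: linear_add[OF lin])
  have scale: "second_derivative F z (c *\<^sub>R v) = (\<lambda>w. c *\<^sub>R second_derivative F z v w)" for c v
    by (rule eqI[OF has_derivative_scaleR_right[OF D2]]) (simp add: linear_scale[OF lin])
  show ?thesis
    unfolding bilinear_def
  proof safe
    show "linear (second_derivative F z v)" for v
      using D2 has_derivative_linear by blast
    show "linear (\<lambda>v. second_derivative F z v w)" for w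
      by (rule linearI) (simp_all add: add scale)
  qed
qed

lemma has_real_derivative_along_line:
  fixes F :: "'a::real_normed_vector \<Rightarrow> real"
  assumes "(F has_derivative F') (at (z + r *\<^sub>R v))"
  shows "((\<lambda>r. F (z + r *\<^sub>R v)) has_real_derivative F' v) (at r)"
proof -
  have "((\<lambda>r. z + r *\<^sub>R v) has_derivative (\<lambda>h. h *\<^sub>R v)) (at r)"
    by (auto intro!: derivative_eq_intros)
  from has_derivative_compose[OF this assms]
  have "((\<lambda>r. F (z + r *\<^sub>R v)) has_derivative (\<lambda>h. F' (h *\<^sub>R v))) (at r)" .
  moreover have "F' (h *\<^sub>R v) = F' v * h" for h
    using linear_scale[OF has_derivative_linear[OF assms]] by simp
  ultimately show ?thesis by (simp add: has_field_derivative_def)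
qed

text \<open>
  The mean value theorem, first along \<open>v\<close> and then along \<open>w\<close>.  The left-hand side is symmetric in \<open>v\<close> and
  \<open>w\<close>, while the right-hand side tends to the second derivative in a definite order of differentiation.
\<close>

lemma second_difference_mean_value:
  fixes F :: "'a::real_normed_vector \<Rightarrow> real"
  assumes F: "C_nat_on 2 S F" and s: "s > 0"
    and S: "\<And>a b. 0 \<le> a \<Longrightarrow> a \<le> s \<Longrightarrow> 0 \<le> b \<Longrightarrow> b \<le> s \<Longrightarrow> z + a *\<^sub>R v + b *\<^sub>R w \<in> S"
  shows "\<exists>a b. 0 < a \<and> a < s \<and> 0 < b \<and> b < s \<and>
    F (z + s *\<^sub>R v + s *\<^sub>R w) - F (z + s *\<^sub>R v) - F (z + s *\<^sub>R w) + F z =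
    s\<^sup>2 * second_derivative F (z + a *\<^sub>R v + b *\<^sub>R w) v w"
proof -
  define g where "g r = F (z + s *\<^sub>R w + r *\<^sub>R v) - F (z + r *\<^sub>R v)" for r
  have "(g has_real_derivative
      (frechet_derivative F (at (z + s *\<^sub>R w + r *\<^sub>R v)) v - frechet_derivative F (at (z + r *\<^sub>R v)) v))
      (at r)" if "0 \<le> r" "r \<le> s" for r
    unfolding g_def
    by (intro DERIV_diff has_real_derivative_along_line C2_on_first[OF F])
       (use S[OF that, of s] S[OF that, of 0] s in \<open>auto simp: algebra_simps\<close>)
  from MVT2[OF s this] obtain a where a: "0 < a" "a < s" and
    ga: "g s - g 0 = s * (frechet_derivative F (at (z + s *\<^sub>R w + a *\<^sub>R v)) v
                  - frechet_derivative F (at (z + a *\<^sub>R v)) v)"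
    by auto
  have "((\<lambda>t. frechet_derivative F (at (z + a *\<^sub>R v + t *\<^sub>R w)) v) has_real_derivative
      second_derivative F (z + a *\<^sub>R v + t *\<^sub>R w) v w) (at t)" if "0 \<le> t" "t \<le> s" for t
    by (rule has_real_derivative_along_line, rule C2_on_second[OF F]) (use S a that in auto)
  from MVT2[OF s this] obtain b where b: "0 < b" "b < s" and
    "frechet_derivative F (at (z + a *\<^sub>R v + s *\<^sub>R w)) v - frechet_derivative F (at (z + a *\<^sub>R v)) v
       = s * second_derivative F (z + a *\<^sub>R v + b *\<^sub>R w) v w"
    by auto
  hence "g s - g 0 = s\<^sup>2 * second_derivative F (z + a *\<^sub>R v + b *\<^sub>R w) v w"
    using ga by (simp add: power2_eq_square algebra_simps)
  thus ?thesis using a b unfolding g_def by (force simp: algebra_simps)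
qed

lemma second_derivative_symmetric:
  fixes F :: "'a::real_normed_vector \<Rightarrow> real"
  assumes F: "C_nat_on 2 S F" and S: "open S" "z \<in> S"
  shows "second_derivative F z v w = second_derivative F z w v"
proof (rule ccontr)
  assume ne: "second_derivative F z v w \<noteq> second_derivative F z w v"
  define \<epsilon> where "\<epsilon> = \<bar>second_derivative F z v w - second_derivative F z w v\<bar> / 2"
  have "\<epsilon> > 0" using ne by (simp add: \<epsilon>_def)
  have near: "\<forall>\<^sub>F x in nhds z. \<bar>second_derivative F x v' w' - second_derivative F z v' w'\<bar> < \<epsilon>" for v' w'
  proof -
    have "isCont (\<lambda>x. second_derivative F x v' w') z"
      using C2_on_continuous_second[OF F] S continuous_on_eq_continuous_at by blast
    hence "((\<lambda>x. second_derivative F x v' w') \<longlongrightarrow> second_derivative F z v' w') (nhds z)"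
      unfolding isCont_def
      by (rule tendsto_at_iff_tendsto_nhds[THEN iffD1])
    from tendstoD[OF this \<open>\<epsilon> > 0\<close>] show ?thesis by (simp add: dist_real_def)
  qed
  have "\<forall>\<^sub>F x in nhds z. x \<in> S \<and>
      \<bar>second_derivative F x v w - second_derivative F z v w\<bar> < \<epsilon> \<and>
      \<bar>second_derivative F x w v - second_derivative F z w v\<bar> < \<epsilon>"
    by (intro eventually_conj near eventually_nhds_in_open S)
  then obtain d where d: "d > 0" and ball: "\<And>x. dist x z < d \<Longrightarrow> x \<in> S \<and>
      \<bar>second_derivative F x v w - second_derivative F z v w\<bar> < \<epsilon> \<and>
      \<bar>second_derivative F x w v - second_derivative F z w v\<bar> < \<epsilon>"
    by (auto simp: eventually_nhds_metric)
  \<comment> \<open>small enough for the parallelogram spanned by \<open>s v\<close> and \<open>s w\<close> at \<open>z\<close> to stay in the ball\<close>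
  define s where "s = d / (norm v + norm w + 1) / 2"
  have s: "s > 0" using d by (simp add: s_def add_nonneg_pos)
  have inball: "dist (z + a *\<^sub>R v + b *\<^sub>R w) z < d" if "0 \<le> a" "a \<le> s" "0 \<le> b" "b \<le> s" for a b
  proof -
    have "norm (a *\<^sub>R v + b *\<^sub>R w) \<le> a * norm v + b * norm w"
      using norm_triangle_ineq[of "a *\<^sub>R v" "b *\<^sub>R w"] that by simp
    also have "\<dots> \<le> s * norm v + s * norm w"
      using that by (intro add_mono mult_right_mono) auto
    also have "\<dots> < 2 * s * (norm v + norm w + 1)"
    proof -
      have "s * norm v \<ge> 0" "s * norm w \<ge> 0" using s by auto
      hence "0 < s * norm v + (s * norm w + s * 2)" using s by linarith
      thus ?thesis by (simp add: algebra_simps)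
    qed
    also have "\<dots> = d" using norm_ge_zero[of v] norm_ge_zero[of w]
      unfolding s_def by (simp add: field_simps add_nonneg_eq_0_iff)
    finally show ?thesis by (simp add: dist_norm add.assoc)
  qed
  obtain a b where ab: "0 < a" "a < s" "0 < b" "b < s"
    "F (z + s *\<^sub>R v + s *\<^sub>R w) - F (z + s *\<^sub>R v) - F (z + s *\<^sub>R w) + F z =
      s\<^sup>2 * second_derivative F (z + a *\<^sub>R v + b *\<^sub>R w) v w"
    using second_difference_mean_value[OF F s, of z v w] ball inball by blast
  \<comment> \<open>the same second difference with the roles of \<open>v\<close> and \<open>w\<close> exchanged\<close>
  have "z + a *\<^sub>R w + b *\<^sub>R v \<in> S" if "0 \<le> a" "a \<le> s" "0 \<le> b" "b \<le> s" for a b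
    using ball[OF inball[OF that(3,4,1,2)]] by (simp add: algebra_simps)
  from second_difference_mean_value[OF F s this] obtain a' b' where ab':
    "0 < a'" "a' < s" "0 < b'" "b' < s"
    "F (z + s *\<^sub>R w + s *\<^sub>R v) - F (z + s *\<^sub>R w) - F (z + s *\<^sub>R v) + F z =
      s\<^sup>2 * second_derivative F (z + a' *\<^sub>R w + b' *\<^sub>R v) w v"
    by blast
  have "s\<^sup>2 * second_derivative F (z + a *\<^sub>R v + b *\<^sub>R w) v w =
        s\<^sup>2 * second_derivative F (z + b' *\<^sub>R v + a' *\<^sub>R w) w v"
    using ab(5) ab'(5) by (simp add: algebra_simps)
  hence "second_derivative F (z + a *\<^sub>R v + b *\<^sub>R w) v w =
        second_derivative F (z + b' *\<^sub>R v + a' *\<^sub>R w) w v"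
    using s by simp
  moreover have "\<bar>second_derivative F (z + a *\<^sub>R v + b *\<^sub>R w) v w - second_derivative F z v w\<bar> < \<epsilon>"
    using ball[OF inball[of a b]] ab by auto
  moreover have "\<bar>second_derivative F (z + b' *\<^sub>R v + a' *\<^sub>R w) w v - second_derivative F z w v\<bar> < \<epsilon>"
    using ball[OF inball[of b' a']] ab' by auto
  ultimately have "\<bar>second_derivative F z v w - second_derivative F z w v\<bar> < 2 * \<epsilon>" by linarith
  thus False by (simp add: \<epsilon>_def)
qed

lemma deriv_deriv_eq_second_derivative:
  fixes F :: "'a::real_normed_vector \<Rightarrow> real"
  assumes F: "C_nat_on 2 S F" and S: "open S" "z \<in> S"
  shows "deriv (\<lambda>s. deriv (\<lambda>t. F (z + s *\<^sub>R v + t *\<^sub>R w)) 0) 0 = second_derivative F z w v"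
proof -
  have "((\<lambda>s. z + s *\<^sub>R v) \<longlongrightarrow> z + 0 *\<^sub>R v) (nhds 0)"
    by (intro tendsto_intros filterlim_ident)
  hence "\<forall>\<^sub>F s in nhds 0. z + s *\<^sub>R v \<in> S"
    using S by (auto dest: topological_tendstoD)
  hence "\<forall>\<^sub>F s in nhds 0. deriv (\<lambda>t. F (z + s *\<^sub>R v + t *\<^sub>R w)) 0 =
           frechet_derivative F (at (z + s *\<^sub>R v)) w"
  proof eventually_elim
    case (elim s)
    show ?case
      by (rule DERIV_imp_deriv has_real_derivative_along_line)+ (use C2_on_first[OF F elim] in simp)
  qed
  hence "deriv (\<lambda>s. deriv (\<lambda>t. F (z + s *\<^sub>R v + t *\<^sub>R w)) 0) 0 =
         deriv (\<lambda>s. frechet_derivative F (at (z + s *\<^sub>R v)) w) 0"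
    by (intro deriv_cong_ev) auto
  also have "\<dots> = second_derivative F z w v"
    by (rule DERIV_imp_deriv has_real_derivative_along_line)+ (use C2_on_second[OF F S(2)] in simp)
  finally show ?thesis .
qed

lemma has_derivative_second_argument:
  assumes "(F has_derivative F') (at (x, y))"
  shows "((\<lambda>y. F (x, y)) has_derivative (\<lambda>b. F' (0, b))) (at y)"
proof -
  have "((\<lambda>y. (x, y)) has_derivative (\<lambda>b. (0, b))) (at y)"
    by (auto intro!: derivative_eq_intros)
  from has_derivative_compose[OF this assms] show ?thesis .
qed

lemma has_derivative_first_argument:
  assumes "(F has_derivative F') (at (x, y))"
  shows "((\<lambda>x. F (x, y)) has_derivative (\<lambda>a. F' (a, 0))) (at x)"
proof -
  have "((\<lambda>x. (x, y)) has_derivative (\<lambda>a. (a, 0))) (at x)"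
    by (auto intro!: derivative_eq_intros)
  from has_derivative_compose[OF this assms] show ?thesis .
qed

lemma has_derivative_unique_eventually:
  assumes "(f has_derivative f') (at x)" "(g has_derivative g') (at x)" "\<forall>\<^sub>F y in nhds x. f y = g y"
  shows "f' = g'"
proof -
  have "f x = g x" using assms(3) by (rule eventually_nhds_x_imp_x)
  moreover have "\<forall>\<^sub>F y in at x. f y = g y"
    using assms(3) by (simp add: eventually_at_filter eventually_mono)
  ultimately have "(g has_derivative f') (at x)"
    using has_derivative_transform_eventually[OF assms(1)] by auto
  thus ?thesis using assms(2) has_derivative_unique by blast
qed

text \<open>
  With \<open>y\<close> fixed, \<open>\<partial>\<^sub>2F(x\<^sub>1, y)b = \<partial>\<^sub>2F'(\<alpha>(x\<^sub>1), \<beta>(y))(\<beta>'b)\<close> with the constant vector \<open>\<beta>'b\<close>, so the second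
  differentiation only meets \<open>\<alpha>\<close> inside the argument.  Hence one derivative of \<open>\<alpha>\<close> and of \<open>\<beta>\<close> at a single
  point is enough.
\<close>

lemma mixed_second_derivative_product_map:
  fixes F :: "'a::real_normed_vector \<times> 'b::real_normed_vector \<Rightarrow> real"
    and F' :: "'c::real_normed_vector \<times> 'd::real_normed_vector \<Rightarrow> real"
  assumes F: "C_nat_on 2 S F" "open S" "(x, y) \<in> S"
    and F': "C_nat_on 2 S' F'" "open S'" "(\<alpha> x, \<beta> y) \<in> S'"
    and \<alpha>: "(\<alpha> has_derivative \<alpha>') (at x)" and \<beta>: "(\<beta> has_derivative \<beta>') (at y)"
    and eq: "\<forall>\<^sub>F x1 in nhds x. \<forall>\<^sub>F y1 in nhds y. F (x1, y1) = F' (\<alpha> x1, \<beta> y1)"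
  shows "second_derivative F (x, y) (0, b) (a, 0) =
         second_derivative F' (\<alpha> x, \<beta> y) (0, \<beta>' b) (\<alpha>' a, 0)"
proof -
  have "((\<lambda>x1. (x1, y)) \<longlongrightarrow> (x, y)) (nhds x)"
    by (intro tendsto_intros filterlim_ident)
  hence S: "\<forall>\<^sub>F x1 in nhds x. (x1, y) \<in> S"
    using F(2,3) by (auto dest: topological_tendstoD)
  have "(\<alpha> \<longlongrightarrow> \<alpha> x) (nhds x)"
    using has_derivative_continuous[OF \<alpha>] tendsto_at_iff_tendsto_nhds
    unfolding continuous_within by blast
  hence "((\<lambda>x1. (\<alpha> x1, \<beta> y)) \<longlongrightarrow> (\<alpha> x, \<beta> y)) (nhds x)"
    by (intro tendsto_intros)
  hence S': "\<forall>\<^sub>F x1 in nhds x. (\<alpha> x1, \<beta> y) \<in> S'"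
    using F'(2,3) by (auto dest: topological_tendstoD)
  have "\<forall>\<^sub>F x1 in nhds x. frechet_derivative F (at (x1, y)) (0, b) =
          frechet_derivative F' (at (\<alpha> x1, \<beta> y)) (0, \<beta>' b)"
    using S S' eq
  proof eventually_elim
    case (elim x1)
    show ?case
      using has_derivative_unique_eventually[OF
          has_derivative_second_argument[OF C2_on_first[OF F(1) elim(1)]]
          has_derivative_compose[OF \<beta>
            has_derivative_second_argument[OF C2_on_first[OF F'(1) elim(2)]]] elim(3)]
      by meson
  qed
  from has_derivative_unique_eventually[OF
      has_derivative_first_argument[OF C2_on_second[OF F(1,3)]]
      has_derivative_compose[OF \<alpha>
        has_derivative_first_argument[OF C2_on_second[OF F'(1,3)]]] this]
  show ?thesis by meson
qed

text \<open>
  The two-form \<open>\<Sum>\<^sub>i\<^sub>j \<partial>\<^sup>2F/\<partial>x\<^sup>i\<partial>y\<^sup>j dx\<^sup>i \<and> dy\<^sup>j\<close>, written without a basis.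
\<close>

definition mixed_form ::
    "('a::real_normed_vector \<times> 'b::real_normed_vector \<Rightarrow> real) \<Rightarrow> 'a \<times> 'b
      \<Rightarrow> 'a \<times> 'b \<Rightarrow> 'a \<times> 'b \<Rightarrow> real" where
  "mixed_form F z u v =
     second_derivative F z (0, snd v) (fst u, 0) - second_derivative F z (0, snd u) (fst v, 0)"

lemma bilinear_mixed_form:
  assumes "C_nat_on 2 S F" "open S" "z \<in> S"
  shows "bilinear (mixed_form F z)"
proof -
  have l1: "linear (\<lambda>u :: 'a \<times> 'b. second_derivative F z (0, snd u) w)"
    and l2: "linear (\<lambda>u :: 'a \<times> 'b. second_derivative F z w (fst u, 0))" for w
  proof -
    note bil = bilinear_second_derivative[OF assms]
    have "linear (\<lambda>u::'a \<times> 'b. (0::'a, snd u))" "linear (\<lambda>u::'a \<times> 'b. (fst u, 0::'b))"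
      by (auto intro!: linearI)
    from linear_compose[OF this(1), of "\<lambda>v. second_derivative F z v w"]
      linear_compose[OF this(2), of "second_derivative F z w"]
    show "linear (\<lambda>u :: 'a \<times> 'b. second_derivative F z (0, snd u) w)"
      "linear (\<lambda>u :: 'a \<times> 'b. second_derivative F z w (fst u, 0))"
      using bil by (simp_all add: bilinear_def comp_def del: split_paired_All)
  qed
  show ?thesis
    unfolding bilinear_def mixed_form_def by (intro conjI allI linear_compose_sub l1 l2)
qed

text \<open>
  \<open>\<gamma>\<close> is the next point determined by the discrete Euler-Lagrange equation \<open>\<partial>\<^sub>2F(x, y) + \<partial>\<^sub>1F'(y, \<gamma>(x, y)) = 0\<close>.
\<close>

lemma mixed_form_generating_function:
  fixes F :: "'a::real_normed_vector \<times> 'b::real_normed_vector \<Rightarrow> real"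
    and F' :: "'b \<times> 'c::real_normed_vector \<Rightarrow> real"
  assumes F: "C_nat_on 2 S F" "open S" "(x, y) \<in> S"
    and F': "C_nat_on 2 S' F'" "open S'" "(y, \<gamma> (x, y)) \<in> S'"
    and \<gamma>: "(\<gamma> has_derivative \<gamma>') (at (x, y))"
    and eq: "\<forall>\<^sub>F p in nhds (x, y). \<forall>w.
      frechet_derivative F (at p) (0, w) + frechet_derivative F' (at (snd p, \<gamma> p)) (w, 0) = 0"
  shows "mixed_form F' (y, \<gamma> (x, y)) (snd u, \<gamma>' u) (snd v, \<gamma>' v) = mixed_form F (x, y) u v"
proof -
  let ?P = "second_derivative F (x, y)" and ?Q = "second_derivative F' (y, \<gamma> (x, y))"
  \<comment> \<open>the equation paired with \<open>w\<close> and differentiated in the direction \<open>u\<close>\<close>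
  have key: "?P (0, w) u + ?Q (w, 0) (snd u, \<gamma>' u) = 0" for w u
  proof -
    have "((\<lambda>p. (snd p, \<gamma> p)) has_derivative (\<lambda>u. (snd u, \<gamma>' u))) (at (x, y))"
      by (intro has_derivative_Pair has_derivative_snd has_derivative_ident \<gamma>)
    from has_derivative_compose[OF this, of "\<lambda>q. frechet_derivative F' (at q) (w, 0)"]
    have "((\<lambda>p. frechet_derivative F' (at (snd p, \<gamma> p)) (w, 0)) has_derivative
            (\<lambda>u. ?Q (w, 0) (snd u, \<gamma>' u))) (at (x, y))"
      using C2_on_second[OF F'(1,3)] by simp
    from has_derivative_unique_eventually[OF
        has_derivative_add[OF C2_on_second[OF F(1,3)] this] has_derivative_const[of 0]]
    show ?thesis using eventually_mono[OF eq] by meson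
  qed
  have split: "\<And>w a b. ?P w (a, b) = ?P w (a, 0) + ?P w (0, b)"
    "\<And>w a b. ?Q w (a, b) = ?Q w (a, 0) + ?Q w (0, b)"
    using bilinear_radd[OF bilinear_second_derivative[OF F]]
      bilinear_radd[OF bilinear_second_derivative[OF F']]
    by (metis add_Pair add_0 add_0_right)+
  have sym: "\<And>v w. ?P v w = ?P w v" "\<And>v w. ?Q v w = ?Q w v"
    using second_derivative_symmetric F F' by blast+
  obtain u1 u2 v1 v2 where uv: "u = (u1, u2)" "v = (v1, v2)" by (metis surj_pair)
  \<comment> \<open>\<open>key\<close> for \<open>(v\<^sub>2, u)\<close> minus \<open>key\<close> for \<open>(u\<^sub>2, v)\<close>: the terms symmetric in \<open>u\<^sub>2, v\<^sub>2\<close> cancel\<close>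
  have "?P (0, v2) (u1, 0) + ?P (0, v2) (0, u2) + ?Q (v2, 0) (u2, 0) + ?Q (v2, 0) (0, \<gamma>' u) = 0"
    using key[of v2 u] uv split by (metis add.assoc snd_conv)
  moreover
  have "?P (0, u2) (v1, 0) + ?P (0, u2) (0, v2) + ?Q (u2, 0) (v2, 0) + ?Q (u2, 0) (0, \<gamma>' v) = 0"
    using key[of u2 v] uv split by (metis add.assoc snd_conv)
  ultimately show ?thesis
    using sym(1)[of "(0, u2)" "(0, v2)"] sym(2)[of "(u2, 0)" "(v2, 0)"]
      sym(2)[of "(v2, 0)" "(0, \<gamma>' u)"] sym(2)[of "(u2, 0)" "(0, \<gamma>' v)"]
    by (simp add: mixed_form_def uv)
qed

section \<open>Charts and tangent maps\<close>

definition is_chart :: "('m::topological_space, 'e::real_normed_vector) chart \<Rightarrow> bool" where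
  "is_chart c \<longleftrightarrow> open (fst c) \<and> open (snd c ` fst c) \<and>
     homeomorphism (fst c) (snd c ` fst c) (snd c) (inv_into (fst c) (snd c))"

abbreviation chart_inv :: "('m, 'e) chart \<Rightarrow> 'e \<Rightarrow> 'm" where
  "chart_inv c \<equiv> inv_into (fst c) (snd c)"

definition prod_chart :: "('m, 'e) chart \<Rightarrow> ('n, 'f) chart \<Rightarrow> ('m \<times> 'n, 'e \<times> 'f) chart" where
  "prod_chart c d = (fst c \<times> fst d, map_prod (snd c) (snd d))"

definition real_chart :: "(real, real) chart" where
  "real_chart = (UNIV, \<lambda>t. t)"

lemma fst_prod_chart [simp]: "fst (prod_chart c d) = fst c \<times> fst d"
  and snd_prod_chart [simp]: "snd (prod_chart c d) = map_prod (snd c) (snd d)"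
  by (simp_all add: prod_chart_def)

lemma chart_inv_image:
  assumes "is_chart c" "x \<in> snd c ` fst c"
  shows "chart_inv c x \<in> fst c" "snd c (chart_inv c x) = x"
  using assms(2) by (auto simp: inv_into_into f_inv_into_f)

lemma chart_inv_chart [simp]:
  assumes "is_chart c" "p \<in> fst c"
  shows "chart_inv c (snd c p) = p"
  using assms unfolding is_chart_def homeomorphism_def by blast

lemma inj_on_chart: "is_chart c \<Longrightarrow> inj_on (snd c) (fst c)"
  by (metis chart_inv_chart inj_onI)

lemma isCont_chart_inv:
  assumes "is_chart c" "x \<in> snd c ` fst c"
  shows "isCont (chart_inv c) x"
  using assms unfolding is_chart_def homeomorphism_def
  by (metis continuous_on_eq_continuous_at)

lemma tendsto_chart_inv:
  assumes "is_chart c" "p \<in> fst c"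
  shows "(chart_inv c \<longlongrightarrow> p) (nhds (snd c p))"
  using isCont_chart_inv[OF assms(1), of "snd c p"] assms
    tendsto_at_iff_tendsto_nhds[of "chart_inv c" "snd c p"]
  by (simp add: isCont_def)

lemma eventually_chart_image:
  assumes "is_chart c" "p \<in> fst c"
  shows "\<forall>\<^sub>F x in nhds (snd c p). x \<in> snd c ` fst c"
  using assms by (intro eventually_nhds_in_open) (auto simp: is_chart_def)

lemma chart_inv_prod_chart:
  assumes "is_chart c" "is_chart d" "x \<in> snd c ` fst c" "y \<in> snd d ` fst d"
  shows "chart_inv (prod_chart c d) (x, y) = (chart_inv c x, chart_inv d y)"
proof (rule inv_into_f_eq)
  show "inj_on (snd (prod_chart c d)) (fst (prod_chart c d))"
    using map_prod_inj_on[OF inj_on_chart inj_on_chart] assms by simp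
qed (use chart_inv_image assms in auto)

lemma continuous_on_map_prod:
  assumes "continuous_on S f" "continuous_on T g"
  shows "continuous_on (S \<times> T) (map_prod f g)"
  unfolding map_prod_def split_beta
  by (intro continuous_on_Pair continuous_on_compose2[OF assms(1)] continuous_on_compose2[OF assms(2)]
      continuous_on_fst continuous_on_snd continuous_on_id) auto

lemma is_chart_prod_chart:
  assumes c: "is_chart c" and d: "is_chart d"
  shows "is_chart (prod_chart c d)"
proof -
  have im: "snd (prod_chart c d) ` fst (prod_chart c d) = snd c ` fst c \<times> snd d ` fst d"
    by auto
  have "homeomorphism (fst c \<times> fst d) (snd c ` fst c \<times> snd d ` fst d)
     (map_prod (snd c) (snd d)) (map_prod (chart_inv c) (chart_inv d))"
    using c d unfolding is_chart_def homeomorphism_def by (auto simp: map_prod_surj_on continuous_on_map_prod)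
  hence "homeomorphism (fst c \<times> fst d) (snd c ` fst c \<times> snd d ` fst d)
     (map_prod (snd c) (snd d)) (chart_inv (prod_chart c d))"
    by (rule homeomorphism_cong) (auto simp: chart_inv_prod_chart[OF c d, unfolded fst_prod_chart snd_prod_chart])
  thus ?thesis
    using c d unfolding is_chart_def[of "prod_chart c d"] im
    by (auto simp: is_chart_def intro!: open_Times)
qed

lemma real_chart_simps [simp]: "fst real_chart = UNIV" "snd real_chart = (\<lambda>t. t)"
  by (simp_all add: real_chart_def)

lemma is_chart_atlas: "smooth_atlas A \<Longrightarrow> c \<in> A \<Longrightarrow> is_chart c"
  unfolding smooth_atlas_def is_chart_def split_beta by blast

lemma chart_at_atlas:
  assumes "smooth_atlas A"
  shows "chart_at A p \<in> A" "p \<in> fst (chart_at A p)"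
proof -
  have "(\<Union>c\<in>A. fst c) = UNIV"
    using assms unfolding smooth_atlas_def split_beta by blast
  hence "\<exists>c. c \<in> A \<and> p \<in> fst c" by blast
  from someI_ex[OF this] show "chart_at A p \<in> A" "p \<in> fst (chart_at A p)"
    by (simp_all add: chart_at_def)
qed

lemma prod_chart_in_prod_atlas: "c \<in> A \<Longrightarrow> d \<in> A' \<Longrightarrow> prod_chart c d \<in> prod_atlas A A'"
  unfolding prod_atlas_def prod_chart_def by (cases c; cases d) auto

lemma prod_atlasE:
  assumes "k \<in> prod_atlas A A'"
  obtains c d where "c \<in> A" "d \<in> A'" "k = prod_chart c d"
proof -
  from assms obtain U \<phi> W \<psi> where "(U, \<phi>) \<in> A" "(W, \<psi>) \<in> A'" "k = (U \<times> W, map_prod \<phi> \<psi>)"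
    unfolding prod_atlas_def by blast
  thus ?thesis using that[of "(U, \<phi>)" "(W, \<psi>)"] by (simp add: prod_chart_def)
qed

lemma chart_at_prod_atlas:
  assumes "smooth_atlas A" "smooth_atlas A'"
  obtains c d where "c \<in> A" "d \<in> A'" "fst p \<in> fst c" "snd p \<in> fst d"
    "chart_at (prod_atlas A A') p = prod_chart c d"
proof -
  let ?c = "prod_chart (chart_at A (fst p)) (chart_at A' (snd p))"
  have "?c \<in> prod_atlas A A' \<and> p \<in> fst ?c"
    using chart_at_atlas[OF assms(1)] chart_at_atlas[OF assms(2)]
    by (simp add: prod_chart_in_prod_atlas mem_Times_iff)
  hence "\<exists>c. c \<in> prod_atlas A A' \<and> p \<in> fst c" by (rule exI)
  from someI_ex[OF this]
  have *: "chart_at (prod_atlas A A') p \<in> prod_atlas A A'" "p \<in> fst (chart_at (prod_atlas A A') p)"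
    by (simp_all add: chart_at_def)
  from *(1) obtain c d where "c \<in> A" "d \<in> A'" "chart_at (prod_atlas A A') p = prod_chart c d"
    by (rule prod_atlasE)
  thus ?thesis using that *(2) by (simp add: mem_Times_iff)
qed

lemma chart_at_real_atlas [simp]: "chart_at real_atlas t = real_chart"
  unfolding chart_at_def by (rule some_equality) (auto simp: real_atlas_def real_chart_def)

text \<open>
  Differentiability at one point relative to freely chosen charts on both sides.  The fixed choice
  \<^const>\<open>chart_at\<close> of charts behind \<^const>\<open>tangent_map\<close> is not compatible with products or with the
  intermediate points of a composition; with free charts the chain rule holds for all of them.  Continuity
  at \<open>p\<close> is part of the definition because differentiability of the representative only controls \<open>f\<close> if \<open>f\<close>
  stays inside the target chart.
\<close>

definition has_tangent ::
    "('m::t2_space, 'e::real_normed_vector) chart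
      \<Rightarrow> ('n::topological_space, 'f::real_normed_vector) chart
      \<Rightarrow> ('m \<Rightarrow> 'n) \<Rightarrow> 'm \<Rightarrow> ('e \<Rightarrow> 'f) \<Rightarrow> bool" where
  "has_tangent c d f p D \<longleftrightarrow> p \<in> fst c \<and> f p \<in> fst d \<and> isCont f p \<and>
     ((\<lambda>x. snd d (f (chart_inv c x))) has_derivative D) (at (snd c p))"

lemma has_tangentD:
  assumes "has_tangent c d f p D"
  shows "p \<in> fst c" "f p \<in> fst d" "isCont f p" "linear D"
    "((\<lambda>x. snd d (f (chart_inv c x))) has_derivative D) (at (snd c p))"
  using assms has_derivative_linear unfolding has_tangent_def by blast+

lemma has_tangent_unique: "has_tangent c d f p D \<Longrightarrow> has_tangent c d f p D' \<Longrightarrow> D = D'"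
  unfolding has_tangent_def using has_derivative_unique by blast

lemma isCont_eventually_in:
  assumes "isCont f p" "open U" "f p \<in> U"
  shows "\<forall>\<^sub>F q in nhds p. f q \<in> U"
proof -
  have "(f \<longlongrightarrow> f p) (nhds p)"
    using assms(1) tendsto_at_iff_tendsto_nhds[of f p] by (simp add: isCont_def)
  thus ?thesis using assms(2,3) by (rule topological_tendstoD)
qed

lemma has_tangent_eventually_in:
  assumes "is_chart c" "is_chart d" "has_tangent c d f p D"
  shows "\<forall>\<^sub>F x in nhds (snd c p). x \<in> snd c ` fst c \<and> f (chart_inv c x) \<in> fst d"
proof -
  note f = has_tangentD[OF assms(3)]
  have "\<forall>\<^sub>F q in nhds p. f q \<in> fst d"
    using isCont_eventually_in[OF f(3) _ f(2)] assms(2) by (simp add: is_chart_def)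
  hence "\<forall>\<^sub>F x in nhds (snd c p). f (chart_inv c x) \<in> fst d"
    using tendsto_chart_inv[OF assms(1) f(1)] by (auto simp: filterlim_iff)
  thus ?thesis using eventually_chart_image[OF assms(1) f(1)] by (rule eventually_conj[rotated])
qed

lemma has_tangent_compose:
  assumes c: "is_chart c" and d: "is_chart d"
    and f: "has_tangent c d f p D" and g: "has_tangent d k g (f p) D'"
  shows "has_tangent c k (\<lambda>x. g (f x)) p (\<lambda>v. D' (D v))"
proof -
  note f' = has_tangentD[OF f] and g' = has_tangentD[OF g]
  have ev: "\<forall>\<^sub>F x in nhds (snd c p). f (chart_inv c x) \<in> fst d"
    using has_tangent_eventually_in[OF c d f] by eventually_elim simp
  have "((\<lambda>x. snd k (g (chart_inv d (snd d (f (chart_inv c x)))))) has_derivative (\<lambda>v. D' (D v)))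
      (at (snd c p))"
    using has_derivative_compose[OF f'(5), of "\<lambda>x. snd k (g (chart_inv d x))" D'] g'(5) c f'(1) by simp
  hence "((\<lambda>x. snd k (g (f (chart_inv c x)))) has_derivative (\<lambda>v. D' (D v))) (at (snd c p))"
  proof (rule has_derivative_transform_eventually)
    show "\<forall>\<^sub>F x in at (snd c p). snd k (g (chart_inv d (snd d (f (chart_inv c x))))) =
            snd k (g (f (chart_inv c x)))"
      using ev d by (simp add: eventually_at_filter) (auto elim: eventually_mono)
  qed (use c d f' in auto)
  thus ?thesis
    using f' g' isCont_o2[OF f'(3) g'(3)] by (simp add: has_tangent_def)
qed

lemma has_tangent_Pair:
  assumes "has_tangent c d f p D" "has_tangent c d' g p D'"
  shows "has_tangent c (prod_chart d d') (\<lambda>x. (f x, g x)) p (\<lambda>v. (D v, D' v))"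
  using assms by (auto simp: has_tangent_def intro!: has_derivative_Pair continuous_intros)

lemma has_tangent_const:
  assumes "p \<in> fst c" "q \<in> fst d"
  shows "has_tangent c d (\<lambda>_. q) p (\<lambda>_. 0)"
  using assms by (simp add: has_tangent_def)

lemma has_tangent_ident:
  assumes "is_chart c" "p \<in> fst c"
  shows "has_tangent c c (\<lambda>x. x) p (\<lambda>v. v)"
proof -
  have "((\<lambda>x. snd c (chart_inv c x)) has_derivative (\<lambda>v. v)) (at (snd c p))"
  proof (rule has_derivative_transform_within_open[OF has_derivative_ident])
    show "open (snd c ` fst c)" using assms by (simp add: is_chart_def)
  qed (use assms in \<open>auto simp: f_inv_into_f\<close>)
  thus ?thesis using assms by (simp add: has_tangent_def)
qed

lemma has_tangent_fst_snd:
  assumes "is_chart c" "is_chart d" "fst p \<in> fst c" "snd p \<in> fst d"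
  shows "has_tangent (prod_chart c d) c fst p fst" "has_tangent (prod_chart c d) d snd p snd"
proof -
  let ?I = "snd c ` fst c \<times> snd d ` fst d"
  have I: "open ?I" "snd (prod_chart c d) p \<in> ?I" "p \<in> fst (prod_chart c d)"
    using assms by (auto simp: is_chart_def intro!: open_Times)
       (auto simp: mem_Times_iff)
  have "chart_inv (prod_chart c d) x = (chart_inv c (fst x), chart_inv d (snd x))" if "x \<in> ?I" for x
    using that chart_inv_prod_chart[OF assms(1,2), of "fst x" "snd x"] by (simp add: mem_Times_iff)
  hence eq: "fst x = snd c (fst (chart_inv (prod_chart c d) x))"
     "snd x = snd d (snd (chart_inv (prod_chart c d) x))" if "x \<in> ?I" for x
    using that chart_inv_image(2)[OF assms(1)] chart_inv_image(2)[OF assms(2)]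
    by (simp_all add: mem_Times_iff)
  have "((\<lambda>x. snd c (fst (chart_inv (prod_chart c d) x))) has_derivative fst)
         (at (snd (prod_chart c d) p))"
    by (rule has_derivative_transform_within_open[OF _ I(1,2) eq(1)])
       (auto intro!: derivative_eq_intros)
  moreover have "((\<lambda>x. snd d (snd (chart_inv (prod_chart c d) x))) has_derivative snd)
         (at (snd (prod_chart c d) p))"
    by (rule has_derivative_transform_within_open[OF _ I(1,2) eq(2)])
       (auto intro!: derivative_eq_intros)
  ultimately show "has_tangent (prod_chart c d) c fst p fst"
    "has_tangent (prod_chart c d) d snd p snd"
    using I(3) assms(3,4) unfolding has_tangent_def by (auto intro!: continuous_intros)
qed

lemma Ck_map_on_has_tangent:
  assumes f: "Ck_map_on k A A' S f" "1 \<le> k" and S: "open S" "p \<in> S"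
    and c: "c \<in> A" "is_chart c" "p \<in> fst c" and d: "d \<in> A'" "f p \<in> fst d"
  obtains D where "has_tangent c d f p D"
proof -
  have "enat (Suc 0) \<le> k" using f(2) by (simp add: one_enat_def)
  hence "C_nat_on (Suc 0) (snd c ` {q \<in> S \<inter> fst c. f q \<in> fst d}) (snd d \<circ> f \<circ> chart_inv c)"
    using f(1) c(1) d(1) unfolding Ck_map_on_def Ck_on_def split_beta by blast
  hence "(snd d \<circ> f \<circ> chart_inv c) differentiable (at (snd c p))"
    using S c d by auto
  moreover have "isCont f p"
    using f(1) S by (auto simp: Ck_map_on_def continuous_on_eq_continuous_at)
  ultimately show ?thesis
    using that c d by (auto simp: has_tangent_def differentiable_def comp_def)
qed

lemma tangent_map_eq:
  assumes "has_tangent (chart_at A p) (chart_at A' (f p)) f p D"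
  shows "tangent_map A A' f p = D"
  using frechet_derivative_at[OF has_tangentD(5)[OF assms]]
  by (simp add: tangent_map_def Let_def split_beta comp_def)

lemma differential_eq:
  assumes "has_tangent (chart_at A p) real_chart f p D"
  shows "differential A f p = D"
  using assms by (intro tangent_map_eq) simp

section \<open>The discrete symplectic form in arbitrary charts\<close>

lemma C2_chart_representative:
  assumes "Ck_map_on \<infinity> A real_atlas UNIV L" "c \<in> A"
  shows "C_nat_on 2 (snd c ` fst c) (L \<circ> chart_inv c)"
proof -
  have "real_chart \<in> real_atlas" by (simp add: real_atlas_def real_chart_def)
  hence "Ck_on \<infinity> (snd c ` {p \<in> UNIV \<inter> fst c. L p \<in> fst real_chart}) (snd real_chart \<circ> L \<circ> chart_inv c)"
    using assms unfolding Ck_map_on_def split_beta by blast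
  thus ?thesis by (simp add: Ck_on_def comp_def)
qed

text \<open>
  The coefficients in the definition are the mixed second derivatives in the basis directions; bilinearity
  sums them up to the coordinate-free form.
\<close>

lemma discrete_symplectic_eq_mixed_form:
  assumes B: "finite B" "independent B" "span B = UNIV" and A: "smooth_atlas A"
    and L: "Ck_map_on \<infinity> (prod_atlas A A) real_atlas UNIV L"
    and C: "C = chart_at (prod_atlas A A) p"
  shows "discrete_symplectic A B L p = mixed_form (L \<circ> chart_inv C) (snd C p)"
proof (intro ext)
  fix u v
  obtain c d where cd: "c \<in> A" "d \<in> A" "fst p \<in> fst c" "snd p \<in> fst d" "C = prod_chart c d"
    using chart_at_prod_atlas[OF A A, of p] C by metis
  have chC: "is_chart C"
    using is_chart_prod_chart[OF cd(1,2)[THEN is_chart_atlas[OF A]]] cd(5) by simp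
  let ?F = "L \<circ> chart_inv C" and ?z = "snd C p" and ?S = "snd C ` fst C"
  have F: "C_nat_on 2 ?S ?F"
    using C2_chart_representative[OF L] prod_chart_in_prod_atlas cd by blast
  have S: "open ?S" "?z \<in> ?S"
    using chC cd by (auto simp: is_chart_def mem_Times_iff)
  let ?M = "\<lambda>a b. second_derivative ?F ?z (0, b) (a, 0)"
  have M: "bilinear ?M"
  proof -
    note bil = bilinear_second_derivative[OF F S]
    have "linear (\<lambda>b. (0, b))" "linear (\<lambda>a. (a, 0))" by (auto intro!: linearI)
    from linear_compose[OF this(1), of "\<lambda>v. second_derivative ?F ?z v w" for w]
      linear_compose[OF this(2), of "second_derivative ?F ?z w" for w]
    show ?thesis using bil by (simp add: bilinear_def comp_def)
  qed
  have expand: "?M a b = (\<Sum>i\<in>B. \<Sum>j\<in>B. ?M i j * (representation B a i * representation B b j))" for a b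
  proof -
    have rep: "(\<Sum>i\<in>B. representation B a i *\<^sub>R i) = a" for a
      using sum_representation_eq[of B a B] B by auto
    have "?M a b = ?M (\<Sum>i\<in>B. representation B a i *\<^sub>R i) (\<Sum>j\<in>B. representation B b j *\<^sub>R j)"
      by (simp only: rep)
    also have "\<dots> = (\<Sum>(i, j)\<in>B \<times> B. ?M (representation B a i *\<^sub>R i) (representation B b j *\<^sub>R j))"
      by (rule bilinear_sum[OF M])
    also have "\<dots> = (\<Sum>i\<in>B. \<Sum>j\<in>B. ?M (representation B a i *\<^sub>R i) (representation B b j *\<^sub>R j))"
      by (simp add: sum.cartesian_product)
    also have "\<dots> = (\<Sum>i\<in>B. \<Sum>j\<in>B. ?M i j * (representation B a i * representation B b j))"
      using bilinear_lmul[OF M] bilinear_rmul[OF M] by (simp add: mult_ac)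
    finally show ?thesis .
  qed
  have coeff: "deriv (\<lambda>s. deriv (\<lambda>t. L (chart_inv C (fst ?z + s *\<^sub>R i, snd ?z + t *\<^sub>R j))) 0) 0 = ?M i j"
    for i j
    using deriv_deriv_eq_second_derivative[OF F S, of "(i, 0)" "(0, j)"]
    by (simp add: plus_prod_def)
  have "discrete_symplectic A B L p u v =
    (\<Sum>i\<in>B. \<Sum>j\<in>B. ?M i j * (representation B (fst u) i * representation B (snd v) j
          - representation B (fst v) i * representation B (snd u) j))"
    unfolding discrete_symplectic_def C[symmetric] Let_def split_beta by (simp only: coeff)
  also have "\<dots> = ?M (fst u) (snd v) - ?M (fst v) (snd u)"
    unfolding expand[where a = "fst u" and b = "snd v"]
      expand[where a = "fst v" and b = "snd u"]
    by (simp add: right_diff_distrib sum_subtractf)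
  finally show "discrete_symplectic A B L p u v = mixed_form ?F ?z u v"
    by (simp add: mixed_form_def)
qed

text \<open>
  Used with \<open>\<alpha>, \<beta>\<close> identities it is the independence of charts, and with \<open>\<alpha> = \<beta>\<close> a right translation the
  invariance under the diagonal action.
\<close>

lemma mixed_form_product_map:
  fixes A :: "('g::t2_space, 'e::real_normed_vector) chart set"
  assumes A: "smooth_atlas A" and L: "Ck_map_on \<infinity> (prod_atlas A A) real_atlas UNIV L"
    and charts: "c1 \<in> A" "c2 \<in> A" "d1 \<in> A" "d2 \<in> A"
    and \<alpha>: "has_tangent c1 d1 \<alpha> g1 \<alpha>'" and \<beta>: "has_tangent c2 d2 \<beta> g2 \<beta>'"
    and inv: "\<And>x y. L (\<alpha> x, \<beta> y) = L (x, y)"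
  shows "mixed_form (L \<circ> chart_inv (prod_chart d1 d2)) (snd d1 (\<alpha> g1), snd d2 (\<beta> g2))
           (map_prod \<alpha>' \<beta>' u) (map_prod \<alpha>' \<beta>' v) =
         mixed_form (L \<circ> chart_inv (prod_chart c1 c2)) (snd c1 g1, snd c2 g2) u v"
proof -
  let ?F = "L \<circ> chart_inv (prod_chart c1 c2)" and ?F' = "L \<circ> chart_inv (prod_chart d1 d2)"
  let ?S = "\<lambda>c d. snd (prod_chart c d) ` fst (prod_chart c d)"
  let ?a = "\<lambda>x. snd d1 (\<alpha> (chart_inv c1 x))" and ?b = "\<lambda>y. snd d2 (\<beta> (chart_inv c2 y))"
  note ch = charts[THEN is_chart_atlas[OF A]]
  note \<alpha>d = has_tangentD[OF \<alpha>] and \<beta>d = has_tangentD[OF \<beta>]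
  have C2: "C_nat_on 2 (?S c d) (L \<circ> chart_inv (prod_chart c d))" if "c \<in> A" "d \<in> A" for c d
    using C2_chart_representative[OF L prod_chart_in_prod_atlas[OF that]] .
  have op: "open (?S c d)" if "is_chart c" "is_chart d" for c d
    using is_chart_prod_chart[OF that] unfolding is_chart_def by blast
  have pt: "?a (snd c1 g1) = snd d1 (\<alpha> g1)" "?b (snd c2 g2) = snd d2 (\<beta> g2)"
    using ch \<alpha>d(1) \<beta>d(1) by simp_all
  have "second_derivative ?F (snd c1 g1, snd c2 g2) (0, b) (a, 0) =
        second_derivative ?F' (?a (snd c1 g1), ?b (snd c2 g2)) (0, \<beta>' b) (\<alpha>' a, 0)" for a b
  proof (rule mixed_second_derivative_product_map[OF C2 op _ C2 op _ \<alpha>d(5) \<beta>d(5)])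
    show "\<forall>\<^sub>F x in nhds (snd c1 g1). \<forall>\<^sub>F y in nhds (snd c2 g2). ?F (x, y) = ?F' (?a x, ?b y)"
      using has_tangent_eventually_in[OF ch(1,3) \<alpha>]
    proof eventually_elim
      case x: (elim x)
      show ?case using has_tangent_eventually_in[OF ch(2,4) \<beta>]
      proof eventually_elim
        case y: (elim y)
        have "?F (x, y) = L (chart_inv c1 x, chart_inv c2 y)"
          using chart_inv_prod_chart[OF ch(1,2)] x y by simp
        moreover have "?F' (?a x, ?b y) = L (\<alpha> (chart_inv c1 x), \<beta> (chart_inv c2 y))"
          using chart_inv_prod_chart[OF ch(3,4), of "?a x" "?b y"] x y ch by simp
        ultimately show ?case by (simp add: inv)
      qed
    qed
  qed (use ch charts \<alpha>d \<beta>d pt in auto)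
  thus ?thesis by (simp add: mixed_form_def pt)
qed

lemma has_tangent_map_prod:
  assumes "is_chart c1" "is_chart c2"
    and "has_tangent c1 d1 \<alpha> (fst p) \<alpha>'" "has_tangent c2 d2 \<beta> (snd p) \<beta>'"
  shows "has_tangent (prod_chart c1 c2) (prod_chart d1 d2) (map_prod \<alpha> \<beta>) p (map_prod \<alpha>' \<beta>')"
proof -
  note ch = assms(1,2) is_chart_prod_chart[OF assms(1,2)]
  note ft = has_tangent_fst_snd[OF ch(1,2) has_tangentD(1)[OF assms(3)] has_tangentD(1)[OF assms(4)]]
  have "has_tangent (prod_chart c1 c2) (prod_chart d1 d2) (\<lambda>x. (\<alpha> (fst x), \<beta> (snd x))) p
          (\<lambda>v. (\<alpha>' (fst v), \<beta>' (snd v)))"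
    by (intro has_tangent_Pair has_tangent_compose[OF ch(3) ch(1) ft(1)]
        has_tangent_compose[OF ch(3) ch(2) ft(2)] assms)
  thus ?thesis unfolding map_prod_def split_beta .
qed

section \<open>Tangent maps on a Lie group\<close>

context lie_group
begin

abbreviation "chart_GG \<equiv> chart_at (prod_atlas A A)"

lemma chartA: "c \<in> A \<Longrightarrow> is_chart c"
  using is_chart_atlas[OF atlas] .

lemmas chart_at_A = chart_at_atlas[OF atlas]
lemmas is_chart_chart_at = chartA[OF chart_at_A(1)]

lemma has_tangent_exists_compose:
  assumes "is_chart c" "is_chart d" "\<exists>D. has_tangent c d f p D" "\<exists>D. has_tangent d k g (f p) D"
  shows "\<exists>D. has_tangent c k (\<lambda>x. g (f x)) p D"
  using has_tangent_compose[OF assms(1,2)] assms(3,4) by blast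

text \<open>
  Only the outer chart \<open>h\<close> is free: the inner ones are fixed as \<^const>\<open>chart_at\<close>, so that the rule and
  its companions can be chained backwards to prove differentiability of any word in the group.
\<close>

lemma has_tangent_mul:
  assumes "is_chart k" "h \<in> A"
    and f: "\<exists>D. has_tangent k (chart_at A (f p)) f p D"
    and g: "\<exists>D. has_tangent k (chart_at A (g p)) g p D"
    and "mul (f p) (g p) \<in> fst h"
  shows "\<exists>D. has_tangent k h (\<lambda>x. mul (f x) (g x)) p D"
proof -
  let ?c = "chart_at A (f p)" and ?d = "chart_at A (g p)"
  have pc: "prod_chart ?c ?d \<in> prod_atlas A A" "is_chart (prod_chart ?c ?d)"
    by (simp_all add: prod_chart_in_prod_atlas chart_at_A is_chart_prod_chart is_chart_chart_at)
  obtain D where "has_tangent (prod_chart ?c ?d) h (\<lambda>(g, h). mul g h) (f p, g p) D"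
    by (rule Ck_map_on_has_tangent[OF smooth_mult _ open_UNIV UNIV_I pc _ assms(2)])
       (use assms chart_at_A in auto)
  thus ?thesis
    using has_tangent_compose[OF assms(1) pc(2) has_tangent_Pair, of f p _ g _ h "\<lambda>(g, h). mul g h"] f g
    by fastforce
qed

lemma has_tangent_ginv:
  assumes "is_chart k" "h \<in> A"
    and f: "\<exists>D. has_tangent k (chart_at A (f p)) f p D" and "ginv (f p) \<in> fst h"
  shows "\<exists>D. has_tangent k h (\<lambda>x. ginv (f x)) p D"
proof -
  have "\<exists>D. has_tangent (chart_at A (f p)) h ginv (f p) D"
    using Ck_map_on_has_tangent[OF smooth_inverse _ open_UNIV UNIV_I chart_at_A(1) is_chart_chart_at
      chart_at_A(2) assms(2,4)] by (metis enat_ord_code(3))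
  thus ?thesis using has_tangent_exists_compose[OF assms(1) is_chart_chart_at f] by blast
qed

lemma has_tangent_chart_change:
  assumes "c \<in> A" "d \<in> A" "g \<in> fst c" "g \<in> fst d"
  shows "\<exists>D. has_tangent c d (\<lambda>x. x) g D"
proof -
  have "snd d \<circ> chart_inv c differentiable at (snd c g)"
  proof -
    have "Ck_on \<infinity> (snd c ` (fst c \<inter> fst d)) (snd d \<circ> chart_inv c)"
      using atlas assms(1,2) unfolding smooth_atlas_def split_beta by blast
    hence "C_nat_on (Suc 0) (snd c ` (fst c \<inter> fst d)) (snd d \<circ> chart_inv c)"
      by (simp add: Ck_on_def)
    thus ?thesis using assms by auto
  qed
  thus ?thesis using assms by (auto simp: has_tangent_def differentiable_def comp_def)
qed

lemma has_tangent_const_A: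
  assumes "p \<in> fst k"
  shows "\<exists>D. has_tangent k (chart_at A q) (\<lambda>_. q) p D"
  using has_tangent_const[OF assms chart_at_A(2)] by blast

lemma has_tangent_ident_A:
  assumes "c \<in> A" "g \<in> fst c"
  shows "\<exists>D. has_tangent c (chart_at A g) (\<lambda>x. x) g D"
  using has_tangent_chart_change[OF assms(1) chart_at_A(1) assms(2) chart_at_A(2)] .

lemma has_tangent_quot_map:
  assumes cd: "c \<in> A" "d \<in> A" "p \<in> fst (prod_chart c d)" and h: "h \<in> A" "quot_map mul ginv p \<in> fst h"
  shows "\<exists>D. has_tangent (prod_chart c d) h (quot_map mul ginv) p D"
proof -
  note ch = chartA[OF cd(1)] chartA[OF cd(2)]
  have pm: "fst p \<in> fst c" "snd p \<in> fst d" using cd(3) by (auto simp: mem_Times_iff)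
  note ft = has_tangent_fst_snd[OF ch pm]
  have 1: "\<exists>D. has_tangent (prod_chart c d) (chart_at A (fst p)) fst p D"
    by (rule has_tangent_exists_compose[where f = fst and g = "\<lambda>x. x", OF is_chart_prod_chart[OF ch] ch(1)])
       (use ft has_tangent_ident_A cd(1) pm in auto)
  have 2: "\<exists>D. has_tangent (prod_chart c d) (chart_at A (snd p)) snd p D"
    by (rule has_tangent_exists_compose[where f = snd and g = "\<lambda>x. x", OF is_chart_prod_chart[OF ch] ch(2)])
       (use ft has_tangent_ident_A cd(2) pm in auto)
  have "\<exists>D. has_tangent (prod_chart c d) h (\<lambda>x. mul (fst x) (ginv (snd x))) p D"
    by (intro has_tangent_mul has_tangent_ginv is_chart_prod_chart ch h(1) 1 2 chart_at_A)
       (use h(2) in \<open>simp add: quot_map_def split_beta\<close>)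
  thus ?thesis by (simp add: quot_map_def split_beta[abs_def])
qed

lemma has_tangent_right_translation:
  assumes "c \<in> A" "d \<in> A" "g1 \<in> fst c" "mul g1 g \<in> fst d"
  shows "\<exists>D. has_tangent c d (\<lambda>x. mul x g) g1 D"
  using assms by (intro has_tangent_mul has_tangent_ident_A has_tangent_const_A chartA)

text \<open>
  The derivative \<open>M\<close> of the multiplication at \<open>(e, e)\<close> is addition, because \<open>h e = h = e h\<close>; differentiating
  \<open>h h\<^sup>-\<^sup>1 = e\<close> gives \<open>v + I v = 0\<close>.
\<close>

lemma tangent_ginv_neutral:
  "has_tangent (chart_at A e) (chart_at A e) ginv e (\<lambda>v. - v)"
proof -
  let ?c = "chart_at A e"
  have c: "is_chart ?c" "e \<in> fst ?c" "?c \<in> A" using is_chart_chart_at chart_at_A by auto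
  have pc: "prod_chart ?c ?c \<in> prod_atlas A A" "is_chart (prod_chart ?c ?c)"
    using c by (simp_all add: prod_chart_in_prod_atlas is_chart_prod_chart)
  obtain M where M: "has_tangent (prod_chart ?c ?c) ?c (\<lambda>(g, h). mul g h) (e, e) M"
    by (rule Ck_map_on_has_tangent[OF smooth_mult _ open_UNIV UNIV_I pc _ c(3), of "(e, e)"])
       (use c in \<open>auto simp: left_neutral\<close>)
  have "\<exists>D. has_tangent ?c ?c (\<lambda>x. ginv x) e D"
    using c by (intro has_tangent_ginv has_tangent_ident_A) (auto simp: inverse_neutral)
  then obtain I where I: "has_tangent ?c ?c ginv e I" by blast
  note ident = has_tangent_ident[OF c(1,2)] and const = has_tangent_const[OF c(2,2)]
  have comp: "has_tangent ?c ?c (\<lambda>x. mul (f x) (g x)) e (\<lambda>v. M (F v, G v))"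
    if "has_tangent ?c ?c f e F" "has_tangent ?c ?c g e G" "f e = e" "g e = e" for f g F G
    using has_tangent_compose[OF c(1) pc(2) has_tangent_Pair[OF that(1,2)],
        of ?c "\<lambda>(g, h). mul g h" M] M that(3,4) by simp
  have M1: "M (v, 0) = v" for v
    using has_tangent_unique[OF comp[OF ident const]] ident by (simp add: fun_eq_iff)
  have M2: "M (0, v) = v" for v
    using has_tangent_unique[OF comp[OF const ident]] ident by (simp add: fun_eq_iff)
  have "M (v, w) = v + w" for v w
    using linear_add[OF has_tangentD(4)[OF M], of "(v, 0)" "(0, w)"] by (simp add: M1 M2)
  moreover have "M (v, I v) = 0" for v
    using has_tangent_unique[OF comp[OF ident I]] const by (simp add: fun_eq_iff inverse_neutral)
  ultimately have "I v = - v" for v by (metis add_eq_0_iff)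
  hence "I = (\<lambda>v. - v)" by (simp add: fun_eq_iff)
  thus ?thesis using I by simp
qed

end

section \<open>The reduced Poisson bracket\<close>

lemma has_tangent_real_add:
  assumes "has_tangent c real_chart f p D" "has_tangent c real_chart g p D'"
  shows "has_tangent c real_chart (\<lambda>x. f x + g x) p (\<lambda>v. D v + D' v)"
  using assms unfolding has_tangent_def by (auto intro!: has_derivative_add continuous_intros)

locale invariant_lagrangian = lie_group mul e ginv A B
  for mul :: "'g::{t2_space, second_countable_topology} \<Rightarrow> 'g \<Rightarrow> 'g"
    and e :: 'g and ginv :: "'g \<Rightarrow> 'g"
    and A :: "('g, 'e::real_normed_vector) chart set" and B :: "'e set" +
  fixes L :: "'g \<times> 'g \<Rightarrow> real" and \<l> :: "'g \<Rightarrow> real"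
  assumes smooth_L: "Ck_map_on \<infinity> (prod_atlas A A) real_atlas UNIV L"
    and invariant: "L (diag_action mul g p) = L p"
    and nondegenerate: "nondegenerate_form (discrete_symplectic A B L p)"
    and reduced: "\<l> (mul g1 (ginv g2)) = L (g1, g2)"
begin

text \<open>
  Every point comes with a pair of charts of \<open>A\<close> in which both the tangent vectors and the form at this
  point are expressed.  Nothing relates the pairs chosen at different points.
\<close>

lemma chart_GG_cases:
  obtains c d where "c \<in> A" "d \<in> A" "fst p \<in> fst c" "snd p \<in> fst d" "chart_GG p = prod_chart c d"
    "is_chart c" "is_chart d"
    "discrete_symplectic A B L p =
       mixed_form (L \<circ> chart_inv (prod_chart c d)) (snd c (fst p), snd d (snd p))"
proof -
  obtain c d where cd: "c \<in> A" "d \<in> A" "fst p \<in> fst c" "snd p \<in> fst d" "chart_GG p = prod_chart c d"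
    using chart_at_prod_atlas[OF atlas atlas, of p] by metis
  show ?thesis
    using that[OF cd] chartA cd(1,2)
      discrete_symplectic_eq_mixed_form[OF finite_basis atlas smooth_L cd(5)[symmetric]]
    by (simp add: map_prod_def split_beta)
qed

lemma C2_L:
  assumes "c \<in> A" "d \<in> A"
  shows "C_nat_on 2 (snd c ` fst c \<times> snd d ` fst d) (L \<circ> chart_inv (prod_chart c d))"
    "open (snd c ` fst c \<times> snd d ` fst d)"
proof -
  have "snd (prod_chart c d) ` fst (prod_chart c d) = snd c ` fst c \<times> snd d ` fst d" by auto
  thus "C_nat_on 2 (snd c ` fst c \<times> snd d ` fst d) (L \<circ> chart_inv (prod_chart c d))"
    using C2_chart_representative[OF smooth_L prod_chart_in_prod_atlas[OF assms]] by simp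
  show "open (snd c ` fst c \<times> snd d ` fst d)"
    using chartA[OF assms(1)] chartA[OF assms(2)] by (intro open_Times) (auto simp: is_chart_def)
qed

lemma bilinear_discrete_symplectic: "bilinear (discrete_symplectic A B L p)"
proof -
  obtain c d where cd: "c \<in> A" "d \<in> A" "fst p \<in> fst c" "snd p \<in> fst d"
    "discrete_symplectic A B L p =
       mixed_form (L \<circ> chart_inv (prod_chart c d)) (snd c (fst p), snd d (snd p))"
    by (rule chart_GG_cases)
  show ?thesis
    unfolding cd(5) by (rule bilinear_mixed_form[OF C2_L[OF cd(1,2)]]) (use cd in auto)
qed

text \<open>
  By the chain rule the differentials at \<open>p\<close> are pullbacks by \<open>T\<close>, so the linear algebra of the bracket
  applies.  It only sees one point, so it serves locally defined maps and functions of class \<open>C\<^sup>1\<close> alike.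
\<close>

lemma poisson_GG_symplectic_pullback:
  assumes \<phi>: "has_tangent (chart_GG p) (chart_GG (\<phi> p)) \<phi> p T"
    and pres: "\<And>u v. discrete_symplectic A B L (\<phi> p) (T u) (T v) = discrete_symplectic A B L p u v"
    and F: "has_tangent (chart_GG (\<phi> p)) real_chart F (\<phi> p) \<alpha>"
    and H: "has_tangent (chart_GG (\<phi> p)) real_chart H (\<phi> p) \<beta>"
  shows "poisson_GG A B L (F \<circ> \<phi>) (H \<circ> \<phi>) p = poisson_GG A B L F H (\<phi> p)"
proof -
  have ch: "is_chart (chart_GG q)" for q
    using chart_GG_cases[of q] is_chart_prod_chart by metis
  have pull: "differential (prod_atlas A A) (F \<circ> \<phi>) p v = differential (prod_atlas A A) F (\<phi> p) (T v)"
    "differential (prod_atlas A A) (H \<circ> \<phi>) p v = differential (prod_atlas A A) H (\<phi> p) (T v)" for v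
    using has_tangent_compose[OF ch ch \<phi> F] has_tangent_compose[OF ch ch \<phi> H] F H
    by (simp_all add: differential_eq comp_def)
  have lin: "linear (differential (prod_atlas A A) F (\<phi> p))" "linear (differential (prod_atlas A A) H (\<phi> p))"
    using differential_eq[OF F] differential_eq[OF H] has_tangentD(4)[OF F] has_tangentD(4)[OF H]
    by simp_all
  obtain S :: "('e \<times> 'e) set" where S: "finite S" "span S = UNIV"
    using finite_span_prod[OF finite_basis(1,3)] by blast
  show ?thesis
    unfolding poisson_GG_def hamiltonian_vf_def
    by (rule form_bracket_natural[OF S bilinear_discrete_symplectic bilinear_discrete_symplectic
          nondegenerate nondegenerate has_tangentD(4)[OF \<phi>] pres lin pull])
qed

lemma differentiable_compose_quot_map:
  assumes c: "c \<in> A" and f: "has_tangent c real_chart f (quot_map mul ginv p) D"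
  shows "\<exists>\<alpha>. has_tangent (chart_GG p) real_chart (f \<circ> quot_map mul ginv) p \<alpha>"
proof -
  obtain c1 c2 where cd: "c1 \<in> A" "c2 \<in> A" "fst p \<in> fst c1" "snd p \<in> fst c2"
    "chart_GG p = prod_chart c1 c2" "is_chart c1" "is_chart c2"
    by (rule chart_GG_cases)
  have "\<exists>D. has_tangent (chart_GG p) c (quot_map mul ginv) p D"
    unfolding cd(5)
    by (rule has_tangent_quot_map) (use cd c has_tangentD(1)[OF f] in \<open>auto simp: mem_Times_iff\<close>)
  moreover have "is_chart (chart_GG p)" using cd is_chart_prod_chart by simp
  ultimately show ?thesis
    unfolding comp_def using has_tangent_exists_compose[OF _ chartA[OF c]] f by blast
qed

lemma quot_map_diag_action [simp]: "quot_map mul ginv (diag_action mul g p) = quot_map mul ginv p"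
  by (simp add: quot_map_def diag_action_def split_beta inverse_distrib_swap assoc)
     (simp add: right_inverse left_neutral flip: assoc)

lemma quot_map_eq_imp_same_orbit:
  assumes "quot_map mul ginv p = quot_map mul ginv q"
  shows "\<exists>g. q = diag_action mul g p"
proof
  have "mul (fst q) (ginv (snd q)) = mul (fst p) (ginv (snd p))"
    using assms by (simp add: quot_map_def split_beta)
  hence "fst q = mul (mul (fst p) (ginv (snd p))) (snd q)"
    by (simp add: assoc left_inverse right_neutral flip: \<open>mul (fst q) (ginv (snd q)) = _\<close>)
  moreover have "snd q = mul (snd p) (mul (ginv (snd p)) (snd q))"
    by (simp add: right_inverse left_neutral flip: assoc)
  ultimately show "q = diag_action mul (mul (ginv (snd p)) (snd q)) p"
    by (cases q) (simp add: diag_action_def split_beta assoc)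
qed

lemma discrete_symplectic_invariant:
  obtains T where "has_tangent (chart_GG p) (chart_GG (diag_action mul g p)) (diag_action mul g) p T"
    "\<And>u v. discrete_symplectic A B L (diag_action mul g p) (T u) (T v) = discrete_symplectic A B L p u v"
proof -
  let ?q = "diag_action mul g p"
  have q: "fst ?q = mul (fst p) g" "snd ?q = mul (snd p) g"
    by (simp_all add: diag_action_def split_beta)
  obtain c1 c2 where c: "c1 \<in> A" "c2 \<in> A" "fst p \<in> fst c1" "snd p \<in> fst c2"
    "chart_GG p = prod_chart c1 c2" "is_chart c1" "is_chart c2"
    "discrete_symplectic A B L p =
       mixed_form (L \<circ> chart_inv (prod_chart c1 c2)) (snd c1 (fst p), snd c2 (snd p))"
    by (rule chart_GG_cases)
  obtain d1 d2 where d: "d1 \<in> A" "d2 \<in> A" "fst ?q \<in> fst d1" "snd ?q \<in> fst d2"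
    "chart_GG ?q = prod_chart d1 d2" "is_chart d1" "is_chart d2"
    "discrete_symplectic A B L ?q =
       mixed_form (L \<circ> chart_inv (prod_chart d1 d2)) (snd d1 (fst ?q), snd d2 (snd ?q))"
    by (rule chart_GG_cases)
  obtain T1 where T1: "has_tangent c1 d1 (\<lambda>x. mul x g) (fst p) T1"
    using has_tangent_right_translation[OF c(1) d(1) c(3)] d(3) q by auto
  obtain T2 where T2: "has_tangent c2 d2 (\<lambda>x. mul x g) (snd p) T2"
    using has_tangent_right_translation[OF c(2) d(2) c(4)] d(4) q by auto
  have act: "diag_action mul g = map_prod (\<lambda>x. mul x g) (\<lambda>x. mul x g)"
    by (simp add: diag_action_def map_prod_def)
  have "L (mul x g, mul y g) = L (x, y)" for x y
    using invariant[of g "(x, y)"] by (simp add: diag_action_def)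
  from mixed_form_product_map[OF atlas smooth_L c(1,2) d(1,2) T1 T2 this]
  show ?thesis
    using that[of "map_prod T1 T2"] has_tangent_map_prod[OF c(6,7) T1 T2] c(5,8) d(5,8)
    by (simp add: act q)
qed

text \<open>
  The fibres of \<open>\<pi>\<close> are the orbits of the diagonal action, which preserves both the form and \<open>f \<circ> \<pi>\<close>.
  Differentiability at a single point suffices, so the lemma also covers \<open>f \<circ> \<Phi>\<close> for a locally defined \<open>\<Phi>\<close>.
\<close>

lemma poisson_G_quot_map:
  assumes "c \<in> A" "d \<in> A" "has_tangent c real_chart f (quot_map mul ginv p) D"
    "has_tangent d real_chart h (quot_map mul ginv p) D'"
  shows "poisson_G mul ginv A B L f h (quot_map mul ginv p) =
    poisson_GG A B L (f \<circ> quot_map mul ginv) (h \<circ> quot_map mul ginv) p"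
proof -
  let ?\<pi> = "quot_map mul ginv"
  have same: "poisson_GG A B L (f \<circ> ?\<pi>) (h \<circ> ?\<pi>) q = poisson_GG A B L (f \<circ> ?\<pi>) (h \<circ> ?\<pi>) p"
    if fibre: "?\<pi> q = ?\<pi> p" for q
  proof -
    obtain g where q: "q = diag_action mul g p"
      using quot_map_eq_imp_same_orbit[OF fibre[symmetric]] by blast
    obtain T where T: "has_tangent (chart_GG p) (chart_GG (diag_action mul g p)) (diag_action mul g) p T"
      "\<And>u v. discrete_symplectic A B L (diag_action mul g p) (T u) (T v) = discrete_symplectic A B L p u v"
      by (rule discrete_symplectic_invariant[of p g]) blast
    obtain \<alpha> where "has_tangent (chart_GG q) real_chart (f \<circ> ?\<pi>) q \<alpha>"
      using differentiable_compose_quot_map[OF assms(1), of f q D] assms(3) fibre by auto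
    moreover obtain \<beta> where "has_tangent (chart_GG q) real_chart (h \<circ> ?\<pi>) q \<beta>"
      using differentiable_compose_quot_map[OF assms(2), of h q D'] assms(4) fibre by auto
    moreover have "F \<circ> ?\<pi> \<circ> diag_action mul g = F \<circ> ?\<pi>" for F :: "'g \<Rightarrow> real"
      by (simp add: fun_eq_iff)
    ultimately show ?thesis
      using poisson_GG_symplectic_pullback[OF T, of "f \<circ> ?\<pi>" \<alpha> "h \<circ> ?\<pi>" \<beta>]
      by (simp only: q)
  qed
  show ?thesis
    unfolding poisson_G_def
  proof (rule the_equality)
    show "\<forall>q. ?\<pi> q = ?\<pi> p \<longrightarrow> poisson_GG A B L (f \<circ> ?\<pi>) (h \<circ> ?\<pi>) q =
        poisson_GG A B L (f \<circ> ?\<pi>) (h \<circ> ?\<pi>) p"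
      by (intro allI impI same)
  qed blast
qed

section \<open>The discrete Euler-Lagrange flow\<close>

text \<open>
  \<open>\<l>\<close> is smooth because \<open>\<l>(g) = L(g, e)\<close>.
\<close>

lemma reduced_has_tangent:
  "\<exists>D. has_tangent (chart_at A g) real_chart \<l> g D"
proof -
  have \<l>: "\<l> = (\<lambda>x. L (x, e))"
    using reduced[of _ e] by (simp add: fun_eq_iff inverse_neutral right_neutral)
  let ?c = "chart_at A g" and ?d = "chart_at A e"
  have pc: "prod_chart ?c ?d \<in> prod_atlas A A" "is_chart (prod_chart ?c ?d)"
    by (simp_all add: prod_chart_in_prod_atlas chart_at_A is_chart_prod_chart is_chart_chart_at)
  have "\<exists>D. has_tangent ?c (prod_chart ?c ?d) (\<lambda>x. (x, e)) g D"
    using has_tangent_Pair has_tangent_ident[OF is_chart_chart_at chart_at_A(2)]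
      has_tangent_const[OF chart_at_A(2) chart_at_A(2)] by blast
  moreover have "\<exists>D. has_tangent (prod_chart ?c ?d) real_chart L (g, e) D"
    using Ck_map_on_has_tangent[OF smooth_L _ open_UNIV UNIV_I pc, of "(g, e)" real_chart]
      chart_at_A(2) by (auto simp: real_atlas_def real_chart_def)
  ultimately show ?thesis
    unfolding \<l> using has_tangent_exists_compose[OF is_chart_chart_at pc(2)] by blast
qed

text \<open>
  Move \<open>k\<close> to the neutral element by \<open>h = k g\<^sub>2\<^sup>-\<^sup>1\<close>.  Then \<open>L(k, g\<^sub>3) = \<l>(h b)\<close> contributes
  \<open>\<l>'(b) TR\<^sub>b \<theta>\<close>, and \<open>L(g\<^sub>1, k) = \<l>((a h\<^sup>-\<^sup>1 a\<^sup>-\<^sup>1) a)\<close> contributes \<open>-\<l>'(a) TR\<^sub>a (Ad\<^sub>a \<theta>)\<close>, the sign coming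
  from the inversion.
\<close>

lemma DEP_imp_discrete_Euler_Lagrange:
  assumes DEP: "DEP mul e ginv A \<l> a b"
    and ab: "mul g1 (ginv g2) = a" "mul g2 (ginv g3) = b"
    and c: "c \<in> A" "g2 \<in> fst c"
  shows "has_tangent c real_chart (\<lambda>k. L (g1, k) + L (k, g3)) g2 (\<lambda>_. 0)"
proof -
  let ?e = "chart_at A e" and ?\<tau> = "\<lambda>k. mul k (ginv g2)"
  have e: "?\<tau> g2 = e" by (simp add: right_inverse)
  obtain \<Theta> where \<Theta>: "has_tangent c ?e ?\<tau> g2 \<Theta>"
    using has_tangent_right_translation[OF c(1) chart_at_A(1) c(2)] e chart_at_A(2) by metis
  have R: "has_tangent ?e (chart_at A g) (\<lambda>h. mul h g) e (right_tangent mul e A g)" for g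
  proof -
    obtain D where D: "has_tangent ?e (chart_at A g) (\<lambda>h. mul h g) e D"
      using has_tangent_right_translation[of ?e "chart_at A g" e g] chart_at_A
      by (auto simp: left_neutral)
    thus ?thesis
      using tangent_map_eq[of A e A "\<lambda>h. mul h g"] by (simp add: right_tangent_def left_neutral)
  qed
  have conj: "mul (mul g e) (ginv g) = e" for g by (simp add: right_neutral right_inverse)
  have Ad: "has_tangent ?e ?e (\<lambda>h. mul (mul g h) (ginv g)) e (Ad mul e ginv A g)" for g
  proof -
    have "\<exists>D. has_tangent ?e ?e (\<lambda>h. mul (mul g h) (ginv g)) e D"
      by (intro has_tangent_mul has_tangent_const_A has_tangent_ident_A is_chart_chart_at chart_at_A)
         (simp add: conj chart_at_A)
    thus ?thesis
      using tangent_map_eq[of A e A "\<lambda>h. mul (mul g h) (ginv g)"] by (auto simp: Ad_def conj)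
  qed
  have d\<l>: "has_tangent (chart_at A g) real_chart \<l> g (differential A \<l> g)" for g
    using reduced_has_tangent[of g] differential_eq[of A g \<l>] by auto
  note ch = is_chart_chart_at
  have c': "is_chart c" using chartA c(1) .
  have f1: "(\<lambda>k. L (g1, k)) =
      (\<lambda>k. \<l> (mul (mul (mul a (ginv (?\<tau> k))) (ginv a)) a))"
  proof
    fix k
    have "mul (mul (mul a (ginv (?\<tau> k))) (ginv a)) a = mul g1 (ginv k)"
      unfolding ab(1)[symmetric]
      by (simp add: assoc inverse_distrib_swap inverse_inverse left_inverse right_neutral)
         (metis assoc left_inverse left_neutral)
    thus "L (g1, k) = \<l> (mul (mul (mul a (ginv (?\<tau> k))) (ginv a)) a)"
      by (simp add: reduced)
  qed
  have f2: "(\<lambda>k. L (k, g3)) = (\<lambda>k. \<l> (mul (?\<tau> k) b))"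
  proof
    fix k
    have "mul (?\<tau> k) b = mul k (ginv g3)"
      unfolding ab(2)[symmetric] by (metis assoc left_inverse left_neutral)
    thus "L (k, g3) = \<l> (mul (?\<tau> k) b)" by (simp add: reduced)
  qed
  have \<l>R: "has_tangent ?e real_chart (\<lambda>h. \<l> (mul h g)) e
      (\<lambda>v. differential A \<l> g (right_tangent mul e A g v))" for g
    using has_tangent_compose[OF ch ch R, where k = real_chart and g = \<l>] d\<l> by (simp add: left_neutral)
  \<comment> \<open>the two terms of the discrete Euler-Poincare equation, up to sign\<close>
  let ?D1 = "\<lambda>v. differential A \<l> a (right_tangent mul e A a (Ad mul e ginv A a v))"
  let ?D2 = "\<lambda>v. differential A \<l> b (right_tangent mul e A b v)"
  have lA: "has_tangent ?e real_chart (\<lambda>h. \<l> (mul (mul (mul a h) (ginv a)) a)) e ?D1"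
    using has_tangent_compose[OF ch ch Ad, where k = real_chart and g = "\<lambda>h. \<l> (mul h a)"] \<l>R[of a] by (simp add: conj)
  have "has_tangent ?e real_chart (\<lambda>h. \<l> (mul (mul (mul a (ginv h)) (ginv a)) a)) e (\<lambda>v. ?D1 (- v))"
    using has_tangent_compose[OF ch ch tangent_ginv_neutral, where k = real_chart and D' = ?D1
        and g = "\<lambda>h. \<l> (mul (mul (mul a h) (ginv a)) a)"] lA
    by (simp add: inverse_neutral)
  hence "has_tangent c real_chart (\<lambda>k. L (g1, k)) g2 (\<lambda>v. ?D1 (- \<Theta> v))"
    using has_tangent_compose[OF c' ch \<Theta>, where k = real_chart
        and g = "\<lambda>h. \<l> (mul (mul (mul a (ginv h)) (ginv a)) a)" and D' = "\<lambda>v. ?D1 (- v)"]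
    unfolding f1 by (simp add: e)
  moreover have "has_tangent c real_chart (\<lambda>k. L (k, g3)) g2 (\<lambda>v. ?D2 (\<Theta> v))"
    using has_tangent_compose[OF c' ch \<Theta>, where k = real_chart and g = "\<lambda>h. \<l> (mul h b)" and D' = ?D2] \<l>R[of b]
    unfolding f2 by (simp add: e)
  ultimately have "has_tangent c real_chart (\<lambda>k. L (g1, k) + L (k, g3)) g2
      (\<lambda>v. ?D1 (- \<Theta> v) + ?D2 (\<Theta> v))"
    by (rule has_tangent_real_add)
  moreover have "?D1 (- \<Theta> v) + ?D2 (\<Theta> v) = 0" for v
    using DEP linear_neg[OF has_tangentD(4)[OF lA]] by (simp add: DEP_def)
  ultimately show ?thesis by simp
qed

text \<open>
  The lift of \<open>\<Phi>\<close> to \<open>G \<times> G\<close>: the second component is the \<open>g\<^sub>3\<close> with \<open>g\<^sub>2 g\<^sub>3\<^sup>-\<^sup>1 = \<Phi>(g\<^sub>1 g\<^sub>2\<^sup>-\<^sup>1)\<close>.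
\<close>

definition euler_lagrange_flow :: "('g \<Rightarrow> 'g) \<Rightarrow> 'g \<times> 'g \<Rightarrow> 'g \<times> 'g" where
  "euler_lagrange_flow \<Phi> p = (snd p, mul (ginv (\<Phi> (quot_map mul ginv p))) (snd p))"

lemma quot_map_euler_lagrange_flow [simp]:
  "quot_map mul ginv (euler_lagrange_flow \<Phi> p) = \<Phi> (quot_map mul ginv p)"
  unfolding euler_lagrange_flow_def
  by (simp add: quot_map_def split_beta inverse_distrib_swap inverse_inverse)
     (simp add: right_inverse left_neutral flip: assoc)

lemma partial_L:
  assumes "c \<in> A" "d \<in> A" "x \<in> snd c ` fst c" "y \<in> snd d ` fst d"
  defines "F \<equiv> L \<circ> chart_inv (prod_chart c d)"
  shows "((\<lambda>y. L (chart_inv c x, chart_inv d y)) has_derivative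
      (\<lambda>w. frechet_derivative F (at (x, y)) (0, w))) (at y)"
    "((\<lambda>x. L (chart_inv c x, chart_inv d y)) has_derivative
      (\<lambda>w. frechet_derivative F (at (x, y)) (w, 0))) (at x)"
proof -
  note ch = chartA[OF assms(1)] chartA[OF assms(2)]
  have F: "F (x', y') = L (chart_inv c x', chart_inv d y')"
    if "x' \<in> snd c ` fst c" "y' \<in> snd d ` fst d" for x' y'
    unfolding F_def using chart_inv_prod_chart[OF ch that] by simp
  have D: "(F has_derivative frechet_derivative F (at (x, y))) (at (x, y))"
    unfolding F_def by (rule C2_on_first[OF C2_L(1)[OF assms(1,2)]]) (use assms in auto)
  have op: "open (snd c ` fst c)" "open (snd d ` fst d)" using ch by (auto simp: is_chart_def)
  show "((\<lambda>y. L (chart_inv c x, chart_inv d y)) has_derivative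
      (\<lambda>w. frechet_derivative F (at (x, y)) (0, w))) (at y)"
    by (rule has_derivative_transform_within_open[OF has_derivative_second_argument[OF D] op(2) assms(4)])
       (use F assms(3) in auto)
  show "((\<lambda>x. L (chart_inv c x, chart_inv d y)) has_derivative
      (\<lambda>w. frechet_derivative F (at (x, y)) (w, 0))) (at x)"
    by (rule has_derivative_transform_within_open[OF has_derivative_first_argument[OF D] op(1) assms(3)])
       (use F assms(4) in auto)
qed

text \<open>
  The generating function argument needs one common chart for the middle point \<open>g\<^sub>2\<close> of the triple
  \<open>(g\<^sub>1, g\<^sub>2, g\<^sub>3)\<close>, while the charts chosen at \<open>(g\<^sub>1, g\<^sub>2)\<close> and at \<open>(g\<^sub>2, g\<^sub>3)\<close> may cover \<open>g\<^sub>2\<close> differently.  So the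
  chart \<open>c\<^sub>2\<close> of the first pair is used for both, followed by the change of charts \<open>\<tau>\<close> from \<open>c\<^sub>2\<close> to \<open>d\<^sub>2\<close>.
\<close>

lemma euler_lagrange_flow_symplectic:
  assumes V: "open V" and \<Phi>: "Ck_map_on \<infinity> A A V \<Phi>"
    and DEP: "\<And>a. a \<in> V \<Longrightarrow> DEP mul e ginv A \<l> a (\<Phi> a)"
    and p: "quot_map mul ginv p \<in> V"
  defines "\<phi> \<equiv> euler_lagrange_flow \<Phi>"
  obtains T where "has_tangent (chart_GG p) (chart_GG (\<phi> p)) \<phi> p T"
    "\<And>u v. discrete_symplectic A B L (\<phi> p) (T u) (T v) = discrete_symplectic A B L p u v"
proof -
  let ?\<pi> = "quot_map mul ginv"
  define G3 where "G3 x = mul (ginv (\<Phi> (?\<pi> x))) (snd x)" for x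
  have \<phi>: "\<phi> = (\<lambda>x. (snd x, G3 x))"
    by (simp add: \<phi>_def euler_lagrange_flow_def G3_def fun_eq_iff)
  obtain c1 c2 where c: "c1 \<in> A" "c2 \<in> A" "fst p \<in> fst c1" "snd p \<in> fst c2"
    "chart_GG p = prod_chart c1 c2" "is_chart c1" "is_chart c2"
    "discrete_symplectic A B L p =
       mixed_form (L \<circ> chart_inv (prod_chart c1 c2)) (snd c1 (fst p), snd c2 (snd p))"
    by (rule chart_GG_cases)
  obtain d2 d3 where d: "d2 \<in> A" "d3 \<in> A" "fst (\<phi> p) \<in> fst d2" "snd (\<phi> p) \<in> fst d3"
    "chart_GG (\<phi> p) = prod_chart d2 d3" "is_chart d2" "is_chart d3"
    "discrete_symplectic A B L (\<phi> p) =
       mixed_form (L \<circ> chart_inv (prod_chart d2 d3)) (snd d2 (fst (\<phi> p)), snd d3 (snd (\<phi> p)))"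
    by (rule chart_GG_cases)
  have p12: "p \<in> fst (prod_chart c1 c2)" using c by (simp add: mem_Times_iff)
  note chp = is_chart_prod_chart[OF c(6,7)]
  note ft = has_tangent_fst_snd[OF c(6,7) c(3,4)]
  have \<pi>: "\<exists>D. has_tangent (prod_chart c1 c2) (chart_at A (?\<pi> p)) ?\<pi> p D"
    by (rule has_tangent_quot_map[OF c(1,2) p12 chart_at_A])
  have "\<exists>D. has_tangent (chart_at A (?\<pi> p)) (chart_at A (\<Phi> (?\<pi> p))) \<Phi> (?\<pi> p) D"
    using Ck_map_on_has_tangent[OF \<Phi> _ V p chart_at_A(1) is_chart_chart_at chart_at_A(2)
        chart_at_A(1) chart_at_A(2)] by (metis enat_ord_code(3))
  hence "\<exists>D. has_tangent (prod_chart c1 c2) (chart_at A (\<Phi> (?\<pi> p))) (\<lambda>x. \<Phi> (?\<pi> x)) p D"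
    by (rule has_tangent_exists_compose[OF chp is_chart_chart_at \<pi>])
  moreover have "\<exists>D. has_tangent (prod_chart c1 c2) (chart_at A (snd p)) snd p D"
    using has_tangent_exists_compose[OF chp c(7), where g = "\<lambda>x. x"] ft(2)
      has_tangent_ident_A[OF c(2,4)] by blast
  ultimately have "\<exists>D. has_tangent (prod_chart c1 c2) d3 (\<lambda>x. mul (ginv (\<Phi> (?\<pi> x))) (snd x)) p D"
    by (intro has_tangent_mul has_tangent_ginv chp d chart_at_A)
       (use d(4) in \<open>simp_all add: \<phi> G3_def\<close>)
  then obtain \<Gamma> where \<Gamma>: "has_tangent (prod_chart c1 c2) d3 G3 p \<Gamma>"
    unfolding G3_def[abs_def] by blast
  obtain \<tau> where \<tau>: "has_tangent c2 d2 (\<lambda>x. x) (snd p) \<tau>"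
    using has_tangent_chart_change[OF c(2) d(1) c(4)] d(3) by (auto simp: \<phi>)
  define T where "T u = (\<tau> (snd u), \<Gamma> u)" for u
  have "has_tangent (prod_chart c1 c2) (prod_chart d2 d3) \<phi> p T"
    unfolding \<phi> T_def[abs_def]
    using has_tangent_Pair[OF has_tangent_compose[OF chp c(7) ft(2) \<tau>] \<Gamma>] .
  hence T: "has_tangent (chart_GG p) (chart_GG (\<phi> p)) \<phi> p T"
    by (simp only: c(5) d(5))

  \<comment> \<open>coordinates \<open>(x, y)\<close> for \<open>(g\<^sub>1, g\<^sub>2)\<close>, and \<open>?\<gamma> (x, y)\<close> the coordinate of \<open>g\<^sub>3\<close>\<close>
  let ?F = "L \<circ> chart_inv (prod_chart c1 c2)" and ?F' = "L \<circ> chart_inv (prod_chart c2 d3)"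
  let ?z = "(snd c1 (fst p), snd c2 (snd p))"
  let ?g = "\<lambda>z. chart_inv (prod_chart c1 c2) z" and ?\<gamma> = "\<lambda>z. snd d3 (G3 (chart_inv (prod_chart c1 c2) z))"
  have z: "snd (prod_chart c1 c2) p = ?z" by (simp add: map_prod_def split_beta)
  have gz: "?g ?z = p" using chart_inv_chart[OF chp p12] unfolding z .
  have G3p: "G3 p \<in> fst d3" using d(4) by (simp add: \<phi>)
  have near: "\<forall>\<^sub>F z in nhds ?z. z \<in> snd (prod_chart c1 c2) ` fst (prod_chart c1 c2) \<and>
      G3 (?g z) \<in> fst d3 \<and> ?\<pi> (?g z) \<in> V"
  proof -
    have "\<forall>\<^sub>F q in nhds p. ?\<pi> q \<in> V"
      using isCont_eventually_in[where f = ?\<pi>, OF _ V p] \<pi> has_tangentD(3) by blast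
    hence "\<forall>\<^sub>F z in nhds ?z. ?\<pi> (?g z) \<in> V"
      using tendsto_chart_inv[OF chp p12, unfolded z] by (auto simp: filterlim_iff)
    thus ?thesis
      using has_tangent_eventually_in[OF chp d(7) \<Gamma>, unfolded z] by eventually_elim simp
  qed
  have DEL: "\<forall>\<^sub>F z in nhds ?z. \<forall>w. frechet_derivative ?F (at z) (0, w) +
      frechet_derivative ?F' (at (snd z, ?\<gamma> z)) (w, 0) = 0"
    using near
  proof eventually_elim
    case (elim z)
    obtain x y where xy: "z = (x, y)" "x \<in> snd c1 ` fst c1" "y \<in> snd c2 ` fst c2"
      using elim by (auto simp: map_prod_def)
    define g1 g2 g3 where g: "g1 = chart_inv c1 x" "g2 = chart_inv c2 y" "g3 = G3 (g1, g2)"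
    have gg: "?g z = (g1, g2)"
      using chart_inv_prod_chart[OF c(6,7) xy(2,3)] by (simp add: xy g)
    have g2: "g2 \<in> fst c2" "snd c2 g2 = y" using chart_inv_image[OF c(7) xy(3)] by (simp_all add: g)
    have g3: "g3 \<in> fst d3" "chart_inv d3 (?\<gamma> z) = g3" "?\<gamma> z \<in> snd d3 ` fst d3"
      using elim d(7) unfolding gg by (simp_all add: g)
    let ?a = "?\<pi> (g1, g2)"
    have "mul g2 (ginv g3) = \<Phi> ?a"
      using quot_map_euler_lagrange_flow[of \<Phi> "(g1, g2)"]
      by (simp add: euler_lagrange_flow_def g G3_def quot_map_def)
    moreover have "mul g1 (ginv g2) = ?a" by (simp add: quot_map_def)
    moreover have "?a \<in> V" using elim by (simp only: gg)
    ultimately have "has_tangent c2 real_chart (\<lambda>k. L (g1, k) + L (k, g3)) g2 (\<lambda>_. 0)"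
      using DEP_imp_discrete_Euler_Lagrange[OF DEP _ _ c(2) g2(1)] by blast
    from has_tangentD(5)[OF this]
    have 0: "((\<lambda>y. L (g1, chart_inv c2 y) + L (chart_inv c2 y, g3)) has_derivative (\<lambda>_. 0)) (at y)"
      by (simp add: g2)
    have "((\<lambda>y. L (g1, chart_inv c2 y) + L (chart_inv c2 y, g3)) has_derivative
      (\<lambda>w. frechet_derivative ?F (at (x, y)) (0, w) + frechet_derivative ?F' (at (y, ?\<gamma> z)) (w, 0))) (at y)"
      using has_derivative_add[OF partial_L(1)[OF c(1,2) xy(2,3)] partial_L(2)[OF c(2) d(2) xy(3) g3(3)]]
      by (simp only: g3(2) flip: g(1))
    from has_derivative_unique[OF this 0] show ?case by (simp add: fun_eq_iff xy)
  qed
  have step: "mixed_form ?F' (snd c2 (snd p), snd d3 (G3 p)) (snd u, \<Gamma> u) (snd v, \<Gamma> v) =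
      mixed_form ?F ?z u v" for u v
  proof -
    have "mixed_form ?F' (snd c2 (snd p), ?\<gamma> ?z) (snd u, \<Gamma> u) (snd v, \<Gamma> v) = mixed_form ?F ?z u v"
    proof (rule mixed_form_generating_function[OF C2_L[OF c(1,2)] _ C2_L[OF c(2) d(2)] _ _ DEL])
      show "?z \<in> snd c1 ` fst c1 \<times> snd c2 ` fst c2" using c(3,4) by simp
      show "(snd c2 (snd p), ?\<gamma> ?z) \<in> snd c2 ` fst c2 \<times> snd d3 ` fst d3"
        unfolding gz using c(4) G3p by simp
      show "(?\<gamma> has_derivative \<Gamma>) (at ?z)" using has_tangentD(5)[OF \<Gamma>] unfolding z .
    qed
    thus ?thesis unfolding gz .
  qed
  have "discrete_symplectic A B L (\<phi> p) (T u) (T v) = discrete_symplectic A B L p u v" for u v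
    using mixed_form_product_map[OF atlas smooth_L c(2) d(2) d(1,2) \<tau>
        has_tangent_ident[OF d(7) G3p], of "(snd u, \<Gamma> u)" "(snd v, \<Gamma> v)"] step[of u v]
    unfolding c(8) d(8) T_def by (simp add: \<phi>)
  thus ?thesis using that T by blast
qed

lemma poisson_G_preserved:
  assumes V: "open V" and \<Phi>: "Ck_map_on \<infinity> A A V \<Phi>"
    and DEP: "\<And>a. a \<in> V \<Longrightarrow> DEP mul e ginv A \<l> a (\<Phi> a)"
    and a: "a \<in> V"
    and f: "\<exists>D. has_tangent (chart_at A (\<Phi> a)) real_chart f (\<Phi> a) D"
    and h: "\<exists>D. has_tangent (chart_at A (\<Phi> a)) real_chart h (\<Phi> a) D"
  shows "poisson_G mul ginv A B L (f \<circ> \<Phi>) (h \<circ> \<Phi>) a = poisson_G mul ginv A B L f h (\<Phi> a)"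
proof -
  let ?\<pi> = "quot_map mul ginv" and ?\<phi> = "euler_lagrange_flow \<Phi>"
  \<comment> \<open>any point of the fibre over \<open>a\<close> would do\<close>
  define p where "p = (a, e)"
  have p: "?\<pi> p = a" by (simp add: p_def quot_map_def inverse_neutral right_neutral)
  have \<pi>: "?\<pi> (?\<phi> p) = \<Phi> a" by (simp add: p)
  obtain T where T: "has_tangent (chart_GG p) (chart_GG (?\<phi> p)) ?\<phi> p T"
    "\<And>u v. discrete_symplectic A B L (?\<phi> p) (T u) (T v) = discrete_symplectic A B L p u v"
    by (rule euler_lagrange_flow_symplectic[OF V \<Phi> DEP, of p]) (use a p in auto)
  have "\<exists>D. has_tangent (chart_at A a) (chart_at A (\<Phi> a)) \<Phi> a D"
    using Ck_map_on_has_tangent[OF \<Phi> _ V a chart_at_A(1) is_chart_chart_at chart_at_A(2)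
        chart_at_A(1) chart_at_A(2)] by (metis enat_ord_code(3))
  note comp = has_tangent_exists_compose[OF is_chart_chart_at is_chart_chart_at this]
  obtain Df Dh where D: "has_tangent (chart_at A a) real_chart (f \<circ> \<Phi>) a Df"
    "has_tangent (chart_at A a) real_chart (h \<circ> \<Phi>) a Dh"
    using comp[OF f] comp[OF h] unfolding comp_def by blast
  obtain D'f D'h where D': "has_tangent (chart_at A (\<Phi> a)) real_chart f (\<Phi> a) D'f"
    "has_tangent (chart_at A (\<Phi> a)) real_chart h (\<Phi> a) D'h"
    using f h by blast
  have flow: "F \<circ> \<Phi> \<circ> ?\<pi> = F \<circ> ?\<pi> \<circ> ?\<phi>" for F :: "'g \<Rightarrow> real"
    by (simp add: fun_eq_iff)
  have "\<exists>\<alpha>. has_tangent (chart_GG (?\<phi> p)) real_chart (F \<circ> ?\<pi>) (?\<phi> p) \<alpha>"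
    if "has_tangent (chart_at A (\<Phi> a)) real_chart F (\<Phi> a) D" for F D
    by (rule differentiable_compose_quot_map[OF chart_at_A(1)]) (use that in \<open>unfold \<pi>, assumption\<close>)
  from this[OF D'(1)] this[OF D'(2)] obtain \<alpha> \<beta> where
    "has_tangent (chart_GG (?\<phi> p)) real_chart (f \<circ> ?\<pi>) (?\<phi> p) \<alpha>"
    "has_tangent (chart_GG (?\<phi> p)) real_chart (h \<circ> ?\<pi>) (?\<phi> p) \<beta>"
    by blast
  note pull = poisson_GG_symplectic_pullback[OF T this]
  have "poisson_G mul ginv A B L (f \<circ> \<Phi>) (h \<circ> \<Phi>) a =
      poisson_GG A B L (f \<circ> \<Phi> \<circ> ?\<pi>) (h \<circ> \<Phi> \<circ> ?\<pi>) p"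
    using poisson_G_quot_map[where p = p, unfolded p, OF chart_at_A(1) chart_at_A(1) D] .
  also have "\<dots> = poisson_GG A B L (f \<circ> ?\<pi>) (h \<circ> ?\<pi>) (?\<phi> p)"
    unfolding flow by (rule pull)
  also have "\<dots> = poisson_G mul ginv A B L f h (\<Phi> a)"
    using poisson_G_quot_map[where p = "?\<phi> p", unfolded \<pi>, OF chart_at_A(1) chart_at_A(1) D', symmetric] .
  finally show ?thesis .
qed

lemma C1_has_tangent:
  assumes "Ck_map_on 1 A real_atlas U f" "open U" "a \<in> U"
  shows "\<exists>D. has_tangent (chart_at A a) real_chart f a D"
  using Ck_map_on_has_tangent[OF assms(1) _ assms(2,3) chart_at_A(1) is_chart_chart_at chart_at_A(2),
      of real_chart] by (auto simp: real_atlas_def real_chart_def)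

end

theorem theorem2p2:
  fixes mul :: "'g::{t2_space, second_countable_topology} \<Rightarrow> 'g \<Rightarrow> 'g"
    and e :: 'g and ginv :: "'g \<Rightarrow> 'g"
    and A :: "('g, 'e::real_normed_vector) chart set" and B :: "'e set"
    and L :: "'g \<times> 'g \<Rightarrow> real" and \<l> :: "'g \<Rightarrow> real"
    and V :: "'g set" and \<Phi> :: "'g \<Rightarrow> 'g"
  assumes "lie_group mul e ginv A B"
    and "Ck_map_on \<infinity> (prod_atlas A A) real_atlas UNIV L"
    and "\<And>g p. L (diag_action mul g p) = L p"
    and "\<And>p. nondegenerate_form (discrete_symplectic A B L p)"
    and "\<And>g1 g2. \<l> (mul g1 (ginv g2)) = L (g1, g2)"
    and "proper_action (diag_action mul)"
    and "open V"
    and "Ck_map_on \<infinity> A A V \<Phi>"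
    and "\<And>a. a \<in> V \<Longrightarrow> DEP mul e ginv A \<l> a (\<Phi> a)"
  shows
    \<comment> \<open>the induced bracket is well defined, also for functions defined on an open set\<close>
    "(\<forall>U f h. open U \<and> Ck_map_on 1 A real_atlas U f \<and> Ck_map_on 1 A real_atlas U h \<longrightarrow>
        (\<forall>p. quot_map mul ginv p \<in> U \<longrightarrow>
           poisson_G mul ginv A B L f h (quot_map mul ginv p) =
           poisson_GG A B L (f \<circ> quot_map mul ginv) (h \<circ> quot_map mul ginv) p)) \<and>
     (\<forall>f h. Ck_map_on 1 A real_atlas UNIV f \<and> Ck_map_on 1 A real_atlas UNIV h \<longrightarrow>
        (\<forall>a\<in>V. poisson_G mul ginv A B L (f \<circ> \<Phi>) (h \<circ> \<Phi>) a =
                (poisson_G mul ginv A B L f h \<circ> \<Phi>) a))"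
proof -
  interpret lie_group mul e ginv A B by fact
  interpret invariant_lagrangian mul e ginv A B L \<l>
    by unfold_locales (rule assms)+
  show ?thesis
  proof (intro conjI allI impI ballI)
    fix U f h p
    assume *: "open U \<and> Ck_map_on 1 A real_atlas U f \<and> Ck_map_on 1 A real_atlas U h"
      "quot_map mul ginv p \<in> U"
    obtain D D' where "has_tangent (chart_at A (quot_map mul ginv p)) real_chart f (quot_map mul ginv p) D"
      "has_tangent (chart_at A (quot_map mul ginv p)) real_chart h (quot_map mul ginv p) D'"
      using C1_has_tangent[OF conjunct1[OF conjunct2[OF *(1)]] conjunct1[OF *(1)] *(2)]
        C1_has_tangent[OF conjunct2[OF conjunct2[OF *(1)]] conjunct1[OF *(1)] *(2)] by blast
    thus "poisson_G mul ginv A B L f h (quot_map mul ginv p) =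
           poisson_GG A B L (f \<circ> quot_map mul ginv) (h \<circ> quot_map mul ginv) p"
      by (rule poisson_G_quot_map[OF chart_at_A(1) chart_at_A(1)])
  next
    fix f h a
    assume *: "Ck_map_on 1 A real_atlas UNIV f \<and> Ck_map_on 1 A real_atlas UNIV h" "a \<in> V"
    show "poisson_G mul ginv A B L (f \<circ> \<Phi>) (h \<circ> \<Phi>) a = (poisson_G mul ginv A B L f h \<circ> \<Phi>) a"
      using poisson_G_preserved[OF assms(7-9) *(2), of f h]
        C1_has_tangent[OF conjunct1[OF *(1)]] C1_has_tangent[OF conjunct2[OF *(1)]] by simp
  qed
qed

end
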